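(* Let $K$ be a field of characteristic $0$ and let $(A,f)$ be a Frobenius algebra over $K$ (finite dimensional, commutative, with unity). Then $A$ contains a field factor in its direct sum decomposition (i.e. there are a field $\mathcal F$ extending $K$ and a $K$-algebra $A'$, possibly zero, with $A\cong \mathcal F\oplus A'$ as $K$-algebras) if and only if the Euler class $e_{A,f}\in A$ is not nilpotent.
   Context: A Frobenius algebra over $K$ is a pair $(A,f)$ where $A$ is a finite dimensional commutative $K$-algebra with unity and $f:A\to K$ is a $K$-linear form such that the bilinear form $\eta(a,b)=f(a\cdot b)$ on $A$ is nondegenerate. If $\{e_i\}$ is a $K$-basis of $A$ and $\{e_j^*\}$ is the dual basis with respect to $\eta$, i.e. $f(e_i\cdot e_j^* )=\delta_{ij}$, the Euler class of $(A,f)$ is $e_{A,f}:=\sum_i e_i\cdot e_i^*\in A$; it is independent of the choice of basis. The direct sum of algebras carries the componentwise product. *)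

theory Defs
  imports "HOL-Algebra.Algebra"
begin

definition char_zero :: "('k, 'm) ring_scheme \<Rightarrow> bool"
  where "char_zero K \<longleftrightarrow> (\<forall>n::nat. [n] \<cdot>\<^bsub>K\<^esub> \<one>\<^bsub>K\<^esub> = \<zero>\<^bsub>K\<^esub> \<longrightarrow> n = 0)"

definition nilpotent :: "('a, 'm) ring_scheme \<Rightarrow> 'a \<Rightarrow> bool"
  where "nilpotent A x \<longleftrightarrow> (\<exists>n::nat. n > 0 \<and> x [^]\<^bsub>A\<^esub> n = \<zero>\<^bsub>A\<^esub>)"


section \<open>Finite bases, linear forms and bilinear forms\<close>

definition finite_basis :: "('k, 'm) ring_scheme \<Rightarrow> ('k, 'a, 'n) module_scheme \<Rightarrow> 'a set \<Rightarrow> bool"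
  where "finite_basis K A B \<longleftrightarrow>
    finite B \<and> B \<subseteq> carrier A \<and>
    (\<forall>x \<in> carrier A. \<exists>c \<in> B \<rightarrow> carrier K. x = (\<Oplus>\<^bsub>A\<^esub>b\<in>B. c b \<odot>\<^bsub>A\<^esub> b)) \<and>
    (\<forall>c \<in> B \<rightarrow> carrier K. (\<Oplus>\<^bsub>A\<^esub>b\<in>B. c b \<odot>\<^bsub>A\<^esub> b) = \<zero>\<^bsub>A\<^esub> \<longrightarrow> (\<forall>b\<in>B. c b = \<zero>\<^bsub>K\<^esub>))"

definition finite_dimensional :: "('k, 'm) ring_scheme \<Rightarrow> ('k, 'a, 'n) module_scheme \<Rightarrow> bool"
  where "finite_dimensional K A \<longleftrightarrow> (\<exists>B. finite_basis K A B)"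

definition linear_form :: "('k, 'm) ring_scheme \<Rightarrow> ('k, 'a, 'n) module_scheme \<Rightarrow> ('a \<Rightarrow> 'k) \<Rightarrow> bool"
  where "linear_form K A f \<longleftrightarrow>
    f \<in> carrier A \<rightarrow> carrier K \<and>
    (\<forall>x \<in> carrier A. \<forall>y \<in> carrier A. f (x \<oplus>\<^bsub>A\<^esub> y) = f x \<oplus>\<^bsub>K\<^esub> f y) \<and>
    (\<forall>c \<in> carrier K. \<forall>x \<in> carrier A. f (c \<odot>\<^bsub>A\<^esub> x) = c \<otimes>\<^bsub>K\<^esub> f x)"

definition nondegenerate ::
    "('k, 'm) ring_scheme \<Rightarrow> ('k, 'a, 'n) module_scheme \<Rightarrow> ('a \<Rightarrow> 'a \<Rightarrow> 'k) \<Rightarrow> bool"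
  where "nondegenerate K A \<eta> \<longleftrightarrow>
    (\<forall>x \<in> carrier A. (\<forall>y \<in> carrier A. \<eta> x y = \<zero>\<^bsub>K\<^esub>) \<longrightarrow> x = \<zero>\<^bsub>A\<^esub>) \<and>
    (\<forall>y \<in> carrier A. (\<forall>x \<in> carrier A. \<eta> x y = \<zero>\<^bsub>K\<^esub>) \<longrightarrow> y = \<zero>\<^bsub>A\<^esub>)"


section \<open>Frobenius algebras and the Euler class\<close>

definition frobenius_form :: "('a, 'n) ring_scheme \<Rightarrow> ('a \<Rightarrow> 'k) \<Rightarrow> 'a \<Rightarrow> 'a \<Rightarrow> 'k"
  where "frobenius_form A f x y = f (x \<otimes>\<^bsub>A\<^esub> y)"

text \<open>The library locale \<^locale>\<open>algebra\<close> consists of commutative algebras with unity; it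
  includes the zero algebra.\<close>

locale frobenius_algebra = K?: field K + A?: algebra K A
  for K :: "('k, 'm) ring_scheme" (structure) and A :: "('k, 'a, 'n) module_scheme" (structure) +
  fixes f :: "'a \<Rightarrow> 'k"
  assumes finite_dimensional: "finite_dimensional K A"
    and linear_form: "linear_form K A f"
    and nondegenerate: "nondegenerate K A (frobenius_form A f)"

text \<open>A basis is a set of vectors, so the dual basis of \<open>B\<close> is a function on \<open>B\<close> that sends
  \<open>e\<close> to \<open>e\<^sup>*\<close>.\<close>

definition dual_basis ::
    "('k, 'm) ring_scheme \<Rightarrow> ('k, 'a, 'n) module_scheme \<Rightarrow> ('a \<Rightarrow> 'k) \<Rightarrow> 'a set \<Rightarrow> ('a \<Rightarrow> 'a) \<Rightarrow> bool"
  where "dual_basis K A f B d \<longleftrightarrow>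
    d \<in> B \<rightarrow> carrier A \<and>
    (\<forall>b\<in>B. \<forall>b'\<in>B. frobenius_form A f b (d b') = (if b = b' then \<one>\<^bsub>K\<^esub> else \<zero>\<^bsub>K\<^esub>))"

text \<open>The definite description below denotes the common value over all bases; independence of the
  basis is lemma \<open>euler_class_eq\<close>.\<close>

definition euler_class ::
    "('k, 'm) ring_scheme \<Rightarrow> ('k, 'a, 'n) module_scheme \<Rightarrow> ('a \<Rightarrow> 'k) \<Rightarrow> 'a"
  where "euler_class K A f =
    (THE e. \<exists>B d. finite_basis K A B \<and> dual_basis K A f B d \<and> e = (\<Oplus>\<^bsub>A\<^esub>b\<in>B. b \<otimes>\<^bsub>A\<^esub> d b))"


section \<open>Direct sums of algebras and field factors\<close>

definition algebra_sum ::
    "('k, 'a, 'm) module_scheme \<Rightarrow> ('k, 'b, 'n) module_scheme \<Rightarrow> ('k, 'a \<times> 'b) module"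
  where "algebra_sum M N =
    ring.extend (RDirProd M N) (module.fields (\<lambda>c (x, y). (c \<odot>\<^bsub>M\<^esub> x, c \<odot>\<^bsub>N\<^esub> y)))"

definition algebra_iso ::
    "('k, 'l) ring_scheme \<Rightarrow> ('k, 'a, 'm) module_scheme \<Rightarrow> ('k, 'b, 'n) module_scheme \<Rightarrow> ('a \<Rightarrow> 'b) set"
  where "algebra_iso K M N =
    {h \<in> ring_iso M N. \<forall>c \<in> carrier K. \<forall>x \<in> carrier M. h (c \<odot>\<^bsub>M\<^esub> x) = c \<odot>\<^bsub>N\<^esub> h x}"

text \<open>A field extending \<open>K\<close> is a \<open>K\<close>-algebra that is a field: its structure map
  \<open>c \<mapsto> c \<odot> \<one>\<close> is automatically injective. Types cannot be quantified existentially, so the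
  summands are taken with elements in the type of \<open>A\<close>. This is no restriction, since both
  summands embed into \<open>A\<close>: see lemma \<open>has_field_factorI\<close>.\<close>

definition has_field_factor :: "('k, 'm) ring_scheme \<Rightarrow> ('k, 'a, 'n) module_scheme \<Rightarrow> bool"
  where "has_field_factor K A \<longleftrightarrow>
    (\<exists>(F :: ('k, 'a) module) (A' :: ('k, 'a) module). field F \<and> algebra K F \<and> algebra K A' \<and>
      algebra_iso K A (algebra_sum F A') \<noteq> {})"


section \<open>Well-definedness of the notions above\<close>

lemma algebra_sum_simps [simp]:
  "carrier (algebra_sum M N) = carrier M \<times> carrier N"
  "(x, y) \<otimes>\<^bsub>algebra_sum M N\<^esub> (x', y') = (x \<otimes>\<^bsub>M\<^esub> x', y \<otimes>\<^bsub>N\<^esub> y')"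
  "\<one>\<^bsub>algebra_sum M N\<^esub> = (\<one>\<^bsub>M\<^esub>, \<one>\<^bsub>N\<^esub>)"
  "(x, y) \<oplus>\<^bsub>algebra_sum M N\<^esub> (x', y') = (x \<oplus>\<^bsub>M\<^esub> x', y \<oplus>\<^bsub>N\<^esub> y')"
  "\<zero>\<^bsub>algebra_sum M N\<^esub> = (\<zero>\<^bsub>M\<^esub>, \<zero>\<^bsub>N\<^esub>)"
  "c \<odot>\<^bsub>algebra_sum M N\<^esub> (x, y) = (c \<odot>\<^bsub>M\<^esub> x, c \<odot>\<^bsub>N\<^esub> y)"
  by (simp_all add: algebra_sum_def RDirProd_def DirProd_def monoid.defs ring.defs module.defs)

lemma algebra_sum_algebra:
  assumes M: "algebra K M" and N: "algebra K N"
  shows "algebra K (algebra_sum M N)"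
proof -
  interpret M: algebra K M by (fact M)
  interpret N: algebra K N by (fact N)
  have "abelian_group (algebra_sum M N)"
  proof (rule abelian_groupI)
    fix p assume "p \<in> carrier (algebra_sum M N)"
    then show "\<exists>q\<in>carrier (algebra_sum M N). q \<oplus>\<^bsub>algebra_sum M N\<^esub> p = \<zero>\<^bsub>algebra_sum M N\<^esub>"
      by (intro bexI[of _ "(\<ominus>\<^bsub>M\<^esub> fst p, \<ominus>\<^bsub>N\<^esub> snd p)"]) (auto simp: M.M.l_neg N.M.l_neg)
  qed (auto simp: M.M.a_ac N.M.a_ac)
  moreover have "comm_monoid (algebra_sum M N)"
    by (rule comm_monoidI) (auto simp: M.m_ac N.m_ac)
  ultimately have "cring (algebra_sum M N)"
    by (intro cringI) (auto simp: M.l_distr N.l_distr)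
  with M.R_cring show ?thesis
    by (rule algebraI)
       (auto simp: M.smult_l_distr M.smult_r_distr M.smult_assoc1 M.smult_assoc2
                   N.smult_l_distr N.smult_r_distr N.smult_assoc1 N.smult_assoc2)
qed

definition image_algebra :: "('a \<Rightarrow> 'b) \<Rightarrow> ('k, 'a, 'n) module_scheme \<Rightarrow> ('k, 'b) module"
  where "image_algebra g M = ring.extend (image_ring g M)
    (module.fields (\<lambda>c y. g (c \<odot>\<^bsub>M\<^esub> inv_into (carrier M) g y)))"

lemma image_algebra_simps:
  "carrier (image_algebra g M) = g ` carrier M"
  "\<one>\<^bsub>image_algebra g M\<^esub> = g \<one>\<^bsub>M\<^esub>"
  "\<zero>\<^bsub>image_algebra g M\<^esub> = g \<zero>\<^bsub>M\<^esub>"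
  by (simp_all add: image_algebra_def image_ring_def image_group_def monoid.defs ring.defs module.defs)

lemma image_algebra_ops:
  assumes "inj_on g (carrier M)"
  shows "x \<in> carrier M \<Longrightarrow> y \<in> carrier M \<Longrightarrow> g x \<otimes>\<^bsub>image_algebra g M\<^esub> g y = g (x \<otimes>\<^bsub>M\<^esub> y)"
    and "x \<in> carrier M \<Longrightarrow> y \<in> carrier M \<Longrightarrow> g x \<oplus>\<^bsub>image_algebra g M\<^esub> g y = g (x \<oplus>\<^bsub>M\<^esub> y)"
    and "x \<in> carrier M \<Longrightarrow> c \<odot>\<^bsub>image_algebra g M\<^esub> g x = g (c \<odot>\<^bsub>M\<^esub> x)"
  using assms
  by (simp_all add: image_algebra_def image_ring_def image_group_def monoid.defs ring.defs module.defs)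

lemma image_algebra_algebra:
  assumes M: "algebra K M" and g: "inj_on g (carrier M)"
  shows "algebra K (image_algebra g M)"
proof -
  interpret M: algebra K M by (fact M)
  note [simp] = image_algebra_simps image_algebra_ops[OF g]
  have "abelian_group (image_algebra g M)"
  proof (rule abelian_groupI)
    fix p assume "p \<in> carrier (image_algebra g M)"
    then obtain x where "x \<in> carrier M" "p = g x" by auto
    then show "\<exists>q\<in>carrier (image_algebra g M). q \<oplus>\<^bsub>image_algebra g M\<^esub> p = \<zero>\<^bsub>image_algebra g M\<^esub>"
      by (intro bexI[of _ "g (\<ominus>\<^bsub>M\<^esub> x)"]) (auto simp: M.M.l_neg)
  qed (auto simp: M.M.a_ac)
  moreover have "comm_monoid (image_algebra g M)"
    by (rule comm_monoidI) (auto simp: M.m_ac)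
  ultimately have "cring (image_algebra g M)"
    by (intro cringI) (auto simp: M.l_distr)
  with M.R_cring show ?thesis
    by (rule algebraI)
       (auto simp: M.smult_l_distr M.smult_r_distr M.smult_assoc1 M.smult_assoc2)
qed

lemma image_algebra_field:
  assumes M: "algebra K M" and F: "field M" and g: "inj_on g (carrier M)"
  shows "field (image_algebra g M)"
proof -
  interpret M: field M by (fact F)
  interpret I: algebra K "image_algebra g M" by (rule image_algebra_algebra[OF M g])
  note [simp] = image_algebra_simps image_algebra_ops[OF g]
  show ?thesis
  proof (rule cring.cring_fieldI2[OF I.M_cring])
    show "\<zero>\<^bsub>image_algebra g M\<^esub> \<noteq> \<one>\<^bsub>image_algebra g M\<^esub>"
      using inj_onD[OF g] M.one_not_zero by fastforce
  next
    fix p assume "p \<in> carrier (image_algebra g M)" "p \<noteq> \<zero>\<^bsub>image_algebra g M\<^esub>"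
    then obtain x where x: "x \<in> carrier M" "p = g x" "x \<noteq> \<zero>\<^bsub>M\<^esub>" by auto
    then have "x \<in> Units M" using M.field_Units by blast
    then obtain y where "y \<in> carrier M" "x \<otimes>\<^bsub>M\<^esub> y = \<one>\<^bsub>M\<^esub>" by (auto simp: Units_def)
    with x show "\<exists>q\<in>carrier (image_algebra g M). p \<otimes>\<^bsub>image_algebra g M\<^esub> q = \<one>\<^bsub>image_algebra g M\<^esub>"
      by force
  qed
qed

lemma has_field_factorI:
  fixes K :: "('k, 'l) ring_scheme" and A :: "('k, 'a, 'n) module_scheme"
    and F :: "('k, 'b, 'p) module_scheme" and A' :: "('k, 'c, 'q) module_scheme"
  assumes F: "field F" "algebra K F" and A': "algebra K A'"
    and h: "h \<in> algebra_iso K A (algebra_sum F A')"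
  shows "has_field_factor K A"
proof -
  interpret F: algebra K F by (fact F)
  interpret A': algebra K A' by (fact A')
  define k where "k = inv_into (carrier A) h"
  define g1 where "g1 = (\<lambda>x. k (x, \<zero>\<^bsub>A'\<^esub>))"
  define g2 where "g2 = (\<lambda>y. k (\<zero>\<^bsub>F\<^esub>, y))"
  have hiso: "h \<in> ring_iso A (algebra_sum F A')" using h by (simp add: algebra_iso_def)
  have bij: "bij_betw h (carrier A) (carrier F \<times> carrier A')"
    using hiso by (simp add: ring_iso_def)
  then have k: "inj_on k (carrier F \<times> carrier A')"
    unfolding k_def by (metis bij_betw_imp_surj_on inj_on_inv_into order_refl)
  have g1: "inj_on g1 (carrier F)"
    using inj_onD[OF k] by (intro inj_onI) (force simp: g1_def)
  have g2: "inj_on g2 (carrier A')"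
    using inj_onD[OF k] by (intro inj_onI) (force simp: g2_def)
  let ?S = "algebra_sum (image_algebra g1 F) (image_algebra g2 A')"
  define h' where "h' = (\<lambda>(x, y). (g1 x, g2 y)) \<circ> h"
  note [simp] = image_algebra_simps image_algebra_ops[OF g1] image_algebra_ops[OF g2]
  have h_cases: "\<exists>x\<in>carrier F. \<exists>y\<in>carrier A'. h a = (x, y)" if "a \<in> carrier A" for a
    using bij_betwE[OF bij] that by fastforce
  have "bij_betw (\<lambda>(x, y). (g1 x, g2 y)) (carrier F \<times> carrier A') (g1 ` carrier F \<times> g2 ` carrier A')"
    using inj_onD[OF g1] inj_onD[OF g2] by (auto simp: bij_betw_def inj_on_def)
  with bij have bij': "bij_betw h' (carrier A) (carrier ?S)"
    unfolding h'_def by (auto intro: bij_betw_trans)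
  have "h' \<in> ring_iso A ?S"
  proof (rule ring_iso_memI)
    fix a b assume a: "a \<in> carrier A" and b: "b \<in> carrier A"
    show "h' a \<in> carrier ?S" using bij_betwE[OF bij'] a by blast
    show "h' (a \<otimes>\<^bsub>A\<^esub> b) = h' a \<otimes>\<^bsub>?S\<^esub> h' b"
      using ring_iso_memE(2)[OF hiso a b] h_cases[OF a] h_cases[OF b] by (auto simp: h'_def)
    show "h' (a \<oplus>\<^bsub>A\<^esub> b) = h' a \<oplus>\<^bsub>?S\<^esub> h' b"
      using ring_iso_memE(3)[OF hiso a b] h_cases[OF a] h_cases[OF b] by (auto simp: h'_def)
  next
    show "h' \<one>\<^bsub>A\<^esub> = \<one>\<^bsub>?S\<^esub>"
      using ring_iso_memE(4)[OF hiso] by (simp add: h'_def)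
  qed (fact bij')
  moreover have "h' (c \<odot>\<^bsub>A\<^esub> a) = c \<odot>\<^bsub>?S\<^esub> h' a" if "c \<in> carrier K" "a \<in> carrier A" for c a
  proof -
    have "h (c \<odot>\<^bsub>A\<^esub> a) = c \<odot>\<^bsub>algebra_sum F A'\<^esub> h a"
      using h that by (simp add: algebra_iso_def)
    then show ?thesis using h_cases[OF that(2)] by (auto simp: h'_def)
  qed
  ultimately have "h' \<in> algebra_iso K A ?S" by (simp add: algebra_iso_def)
  then show ?thesis
    unfolding has_field_factor_def
    using image_algebra_field[OF F(2,1) g1] image_algebra_algebra[OF F(2) g1]
      image_algebra_algebra[OF A' g2] by blast
qed

context frobenius_algebra
begin

lemma A_semiring: "semiring A"
  by unfold_locales

lemma form_closed: "x \<in> carrier A \<Longrightarrow> f x \<in> carrier K"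
  using linear_form by (auto simp: linear_form_def)

lemma form_add: "x \<in> carrier A \<Longrightarrow> y \<in> carrier A \<Longrightarrow> f (x \<oplus>\<^bsub>A\<^esub> y) = f x \<oplus>\<^bsub>K\<^esub> f y"
  using linear_form by (auto simp: linear_form_def)

lemma form_smult: "c \<in> carrier K \<Longrightarrow> x \<in> carrier A \<Longrightarrow> f (c \<odot>\<^bsub>A\<^esub> x) = c \<otimes>\<^bsub>K\<^esub> f x"
  using linear_form by (auto simp: linear_form_def)

lemma form_zero: "f \<zero>\<^bsub>A\<^esub> = \<zero>\<^bsub>K\<^esub>"
  using form_smult[of "\<zero>\<^bsub>K\<^esub>" "\<zero>\<^bsub>A\<^esub>"] form_closed[of "\<zero>\<^bsub>A\<^esub>"] by simp

lemma form_minus: "x \<in> carrier A \<Longrightarrow> y \<in> carrier A \<Longrightarrow> f (x \<ominus>\<^bsub>A\<^esub> y) = f x \<ominus>\<^bsub>K\<^esub> f y"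
proof -
  assume x: "x \<in> carrier A" and y: "y \<in> carrier A"
  have "f (\<ominus>\<^bsub>A\<^esub> y) \<oplus>\<^bsub>K\<^esub> f y = \<zero>\<^bsub>K\<^esub>"
    using form_add[of "\<ominus>\<^bsub>A\<^esub> y" y] y by (simp add: form_zero A.M.l_neg)
  then have "f (\<ominus>\<^bsub>A\<^esub> y) = \<ominus>\<^bsub>K\<^esub> f y"
    using form_closed y by (metis A.M.a_inv_closed K.minus_equality)
  then show ?thesis using x y by (simp add: a_minus_def form_add)
qed

lemma form_finsum:
  assumes "finite B" "c \<in> B \<rightarrow> carrier K" "v \<in> B \<rightarrow> carrier A"
  shows "f (\<Oplus>\<^bsub>A\<^esub>b\<in>B. c b \<odot>\<^bsub>A\<^esub> v b) = (\<Oplus>\<^bsub>K\<^esub>b\<in>B. c b \<otimes>\<^bsub>K\<^esub> f (v b))"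
  using assms
proof (induction rule: finite_induct)
  case (insert b B)
  then have "(\<lambda>b. c b \<odot>\<^bsub>A\<^esub> v b) \<in> B \<rightarrow> carrier A" "(\<lambda>b. c b \<otimes>\<^bsub>K\<^esub> f (v b)) \<in> B \<rightarrow> carrier K"
    by (auto simp: Pi_iff form_closed)
  with insert show ?case
    by (simp add: form_add form_smult form_closed Pi_iff A.M.finsum_closed)
qed (simp add: form_zero)

lemma basis_expansion:
  assumes B: "finite_basis K A B" and d: "dual_basis K A f B d" and x: "x \<in> carrier A"
  shows "x = (\<Oplus>\<^bsub>A\<^esub>b\<in>B. f (x \<otimes>\<^bsub>A\<^esub> d b) \<odot>\<^bsub>A\<^esub> b)"
proof -
  have fin: "finite B" and BA: "B \<subseteq> carrier A" using B by (auto simp: finite_basis_def)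
  have dA: "d \<in> B \<rightarrow> carrier A" using d by (simp add: dual_basis_def)
  obtain c where c: "c \<in> B \<rightarrow> carrier K" and xc: "x = (\<Oplus>\<^bsub>A\<^esub>b\<in>B. c b \<odot>\<^bsub>A\<^esub> b)"
    using B x unfolding finite_basis_def by blast
  have "f (x \<otimes>\<^bsub>A\<^esub> d b') = c b'" if b': "b' \<in> B" for b'
  proof -
    have "x \<otimes>\<^bsub>A\<^esub> d b' = (\<Oplus>\<^bsub>A\<^esub>b\<in>B. (c b \<odot>\<^bsub>A\<^esub> b) \<otimes>\<^bsub>A\<^esub> d b')"
      unfolding xc using b' c BA dA fin
      by (intro semiring.finsum_ldistr[OF A_semiring])
         (auto simp: Pi_iff subset_iff)
    also have "\<dots> = (\<Oplus>\<^bsub>A\<^esub>b\<in>B. c b \<odot>\<^bsub>A\<^esub> (b \<otimes>\<^bsub>A\<^esub> d b'))"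
      using b' c BA dA by (intro A.M.finsum_cong') (auto simp: Pi_iff subset_iff A.smult_assoc2)
    also have "f \<dots> = (\<Oplus>\<^bsub>K\<^esub>b\<in>B. c b \<otimes>\<^bsub>K\<^esub> f (b \<otimes>\<^bsub>A\<^esub> d b'))"
      using b' c BA dA fin by (intro form_finsum) (auto simp: Pi_iff subset_iff)
    also have "\<dots> = (\<Oplus>\<^bsub>K\<^esub>b\<in>B. if b' = b then c b else \<zero>\<^bsub>K\<^esub>)"
      using b' c d by (intro K.finsum_cong') (auto simp: Pi_iff dual_basis_def frobenius_form_def)
    also have "\<dots> = c b'"
      using b' c fin by (intro K.finsum_singleton) auto
    finally show ?thesis .
  qed
  then show ?thesis
    using c BA by (subst xc, intro A.M.finsum_cong') (auto simp: Pi_iff subset_iff)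
qed

lemma dual_basis_expansion:
  assumes B: "finite_basis K A B" and d: "dual_basis K A f B d" and x: "x \<in> carrier A"
  shows "x = (\<Oplus>\<^bsub>A\<^esub>b\<in>B. f (x \<otimes>\<^bsub>A\<^esub> b) \<odot>\<^bsub>A\<^esub> d b)"
proof -
  have fin: "finite B" and BA: "B \<subseteq> carrier A" using B by (auto simp: finite_basis_def)
  have dA: "d \<in> B \<rightarrow> carrier A" using d by (simp add: dual_basis_def)
  define y where "y = (\<Oplus>\<^bsub>A\<^esub>b\<in>B. f (x \<otimes>\<^bsub>A\<^esub> b) \<odot>\<^bsub>A\<^esub> d b)"
  have fxb: "f (x \<otimes>\<^bsub>A\<^esub> b) \<in> carrier K" if "b \<in> B" for b
    using that x BA by (intro form_closed) auto
  have y: "y \<in> carrier A"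
    unfolding y_def using dA fxb by (intro A.M.finsum_closed) auto
  have eq: "f (z \<otimes>\<^bsub>A\<^esub> y) = f (z \<otimes>\<^bsub>A\<^esub> x)" if z: "z \<in> carrier A" for z
  proof -
    have "z \<otimes>\<^bsub>A\<^esub> y = (\<Oplus>\<^bsub>A\<^esub>b\<in>B. z \<otimes>\<^bsub>A\<^esub> (f (x \<otimes>\<^bsub>A\<^esub> b) \<odot>\<^bsub>A\<^esub> d b))"
      unfolding y_def using z dA fin fxb
      by (intro semiring.finsum_rdistr[OF A_semiring]) auto
    also have "\<dots> = (\<Oplus>\<^bsub>A\<^esub>b\<in>B. f (x \<otimes>\<^bsub>A\<^esub> b) \<odot>\<^bsub>A\<^esub> (z \<otimes>\<^bsub>A\<^esub> d b))"
      using z dA fxb by (intro A.M.finsum_cong') (auto simp: Pi_iff A.smult_assoc2 A.m_comm[of z])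
    also have "f \<dots> = (\<Oplus>\<^bsub>K\<^esub>b\<in>B. f (x \<otimes>\<^bsub>A\<^esub> b) \<otimes>\<^bsub>K\<^esub> f (z \<otimes>\<^bsub>A\<^esub> d b))"
      using z dA fin fxb by (intro form_finsum) auto
    also have "\<dots> = (\<Oplus>\<^bsub>K\<^esub>b\<in>B. f (z \<otimes>\<^bsub>A\<^esub> d b) \<otimes>\<^bsub>K\<^esub> f (b \<otimes>\<^bsub>A\<^esub> x))"
      using z x dA BA fxb
      by (intro K.finsum_cong') (auto simp: Pi_iff subset_iff form_closed K.m_comm A.m_comm[of x])
    also have "\<dots> = f (\<Oplus>\<^bsub>A\<^esub>b\<in>B. f (z \<otimes>\<^bsub>A\<^esub> d b) \<odot>\<^bsub>A\<^esub> (b \<otimes>\<^bsub>A\<^esub> x))"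
      using z x dA BA fin by (intro form_finsum[symmetric]) (auto simp: Pi_iff subset_iff form_closed)
    also have "(\<Oplus>\<^bsub>A\<^esub>b\<in>B. f (z \<otimes>\<^bsub>A\<^esub> d b) \<odot>\<^bsub>A\<^esub> (b \<otimes>\<^bsub>A\<^esub> x)) =
        (\<Oplus>\<^bsub>A\<^esub>b\<in>B. (f (z \<otimes>\<^bsub>A\<^esub> d b) \<odot>\<^bsub>A\<^esub> b) \<otimes>\<^bsub>A\<^esub> x)"
      using z x dA BA
      by (intro A.M.finsum_cong') (auto simp: Pi_iff subset_iff form_closed A.smult_assoc2)
    also have "\<dots> = (\<Oplus>\<^bsub>A\<^esub>b\<in>B. f (z \<otimes>\<^bsub>A\<^esub> d b) \<odot>\<^bsub>A\<^esub> b) \<otimes>\<^bsub>A\<^esub> x"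
      using z x dA BA fin
      by (intro semiring.finsum_ldistr[OF A_semiring, symmetric])
         (auto simp: Pi_iff subset_iff form_closed)
    also have "(\<Oplus>\<^bsub>A\<^esub>b\<in>B. f (z \<otimes>\<^bsub>A\<^esub> d b) \<odot>\<^bsub>A\<^esub> b) = z"
      using basis_expansion[OF B d z] by simp
    finally show ?thesis .
  qed
  have "f (z \<otimes>\<^bsub>A\<^esub> (y \<ominus>\<^bsub>A\<^esub> x)) = \<zero>\<^bsub>K\<^esub>" if z: "z \<in> carrier A" for z
  proof -
    have "z \<otimes>\<^bsub>A\<^esub> (y \<ominus>\<^bsub>A\<^esub> x) = z \<otimes>\<^bsub>A\<^esub> y \<ominus>\<^bsub>A\<^esub> z \<otimes>\<^bsub>A\<^esub> x"
      using x y z cring.axioms(1)[OF A.M_cring] by (simp add: a_minus_def ring.ring_simprules)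
    then show ?thesis using x y z by (simp add: form_minus eq form_closed K.r_right_minus_eq)
  qed
  then have "y \<ominus>\<^bsub>A\<^esub> x = \<zero>\<^bsub>A\<^esub>"
    using nondegenerate x y by (simp add: nondegenerate_def frobenius_form_def)
  then show ?thesis using x y unfolding y_def[symmetric] by (simp add: A.r_right_minus_eq)
qed

lemma euler_class_eq:
  assumes B: "finite_basis K A B" and d: "dual_basis K A f B d"
  shows "euler_class K A f = (\<Oplus>\<^bsub>A\<^esub>b\<in>B. b \<otimes>\<^bsub>A\<^esub> d b)"
  unfolding euler_class_def
proof (rule the_equality)
  fix e assume "\<exists>C g. finite_basis K A C \<and> dual_basis K A f C g \<and> e = (\<Oplus>\<^bsub>A\<^esub>c\<in>C. c \<otimes>\<^bsub>A\<^esub> g c)"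
  then obtain C g where C: "finite_basis K A C" and g: "dual_basis K A f C g"
    and e: "e = (\<Oplus>\<^bsub>A\<^esub>c\<in>C. c \<otimes>\<^bsub>A\<^esub> g c)" by blast
  have fin: "finite B" "finite C" and car: "\<And>b. b \<in> B \<Longrightarrow> b \<in> carrier A" "\<And>c. c \<in> C \<Longrightarrow> c \<in> carrier A"
    "\<And>b. b \<in> B \<Longrightarrow> d b \<in> carrier A" "\<And>c. c \<in> C \<Longrightarrow> g c \<in> carrier A"
    using B C d g by (auto simp: finite_basis_def dual_basis_def)
  let ?t = "\<lambda>b c. f (b \<otimes>\<^bsub>A\<^esub> g c) \<odot>\<^bsub>A\<^esub> (c \<otimes>\<^bsub>A\<^esub> d b)"
  have t: "?t b c \<in> carrier A" if "b \<in> B" "c \<in> C" for b c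
    using that by (simp add: car form_closed)
  have 1: "b \<otimes>\<^bsub>A\<^esub> d b = (\<Oplus>\<^bsub>A\<^esub>c\<in>C. ?t b c)" if b: "b \<in> B" for b
  proof -
    have "b \<otimes>\<^bsub>A\<^esub> d b = (\<Oplus>\<^bsub>A\<^esub>c\<in>C. f (b \<otimes>\<^bsub>A\<^esub> g c) \<odot>\<^bsub>A\<^esub> c) \<otimes>\<^bsub>A\<^esub> d b"
      using basis_expansion[OF C g car(1)[OF b]] by simp
    also have "\<dots> = (\<Oplus>\<^bsub>A\<^esub>c\<in>C. (f (b \<otimes>\<^bsub>A\<^esub> g c) \<odot>\<^bsub>A\<^esub> c) \<otimes>\<^bsub>A\<^esub> d b)"
      using b fin by (intro semiring.finsum_ldistr[OF A_semiring]) (auto simp: car form_closed)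
    also have "\<dots> = (\<Oplus>\<^bsub>A\<^esub>c\<in>C. ?t b c)"
      using b by (intro A.M.finsum_cong') (auto simp: car form_closed A.smult_assoc2)
    finally show ?thesis .
  qed
  have 2: "(\<Oplus>\<^bsub>A\<^esub>b\<in>B. ?t b c) = c \<otimes>\<^bsub>A\<^esub> g c" if c: "c \<in> C" for c
  proof -
    have "(\<Oplus>\<^bsub>A\<^esub>b\<in>B. ?t b c) = (\<Oplus>\<^bsub>A\<^esub>b\<in>B. c \<otimes>\<^bsub>A\<^esub> (f (g c \<otimes>\<^bsub>A\<^esub> b) \<odot>\<^bsub>A\<^esub> d b))"
      using c by (intro A.M.finsum_cong')
        (auto simp: car form_closed A.smult_assoc2 A.m_comm[of c] A.m_comm[of "g c"])
    also have "\<dots> = c \<otimes>\<^bsub>A\<^esub> (\<Oplus>\<^bsub>A\<^esub>b\<in>B. f (g c \<otimes>\<^bsub>A\<^esub> b) \<odot>\<^bsub>A\<^esub> d b)"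
      using c fin by (intro semiring.finsum_rdistr[OF A_semiring, symmetric]) (auto simp: car form_closed)
    also have "\<dots> = c \<otimes>\<^bsub>A\<^esub> g c"
      using dual_basis_expansion[OF B d car(4)[OF c]] by simp
    finally show ?thesis .
  qed
  have swap: "(\<Oplus>\<^bsub>A\<^esub>b\<in>B'. \<Oplus>\<^bsub>A\<^esub>c\<in>C. ?t b c) = (\<Oplus>\<^bsub>A\<^esub>c\<in>C. \<Oplus>\<^bsub>A\<^esub>b\<in>B'. ?t b c)"
    if "B' \<subseteq> B" for B'
    using finite_subset[OF that fin(1)] that
  proof (induction rule: finite_induct)
    case (insert b B')
    then have b: "b \<in> B" and B': "\<And>b. b \<in> B' \<Longrightarrow> b \<in> B" by auto
    have "(\<Oplus>\<^bsub>A\<^esub>c\<in>C. \<Oplus>\<^bsub>A\<^esub>b\<in>insert b B'. ?t b c) =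
        (\<Oplus>\<^bsub>A\<^esub>c\<in>C. ?t b c \<oplus>\<^bsub>A\<^esub> (\<Oplus>\<^bsub>A\<^esub>b\<in>B'. ?t b c))"
      using insert.hyps t[OF b] t[OF B']
      by (intro A.M.finsum_cong' A.M.finsum_insert) (auto intro!: A.M.finsum_closed)
    also have "\<dots> = (\<Oplus>\<^bsub>A\<^esub>c\<in>C. ?t b c) \<oplus>\<^bsub>A\<^esub> (\<Oplus>\<^bsub>A\<^esub>c\<in>C. \<Oplus>\<^bsub>A\<^esub>b\<in>B'. ?t b c)"
      using t[OF b] t[OF B'] by (intro A.M.finsum_addf) (auto intro!: A.M.finsum_closed)
    also have "\<dots> = (\<Oplus>\<^bsub>A\<^esub>b\<in>insert b B'. \<Oplus>\<^bsub>A\<^esub>c\<in>C. ?t b c)"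
      using insert t[OF b] t[OF B']
      by (subst A.M.finsum_insert) (auto intro!: A.M.finsum_closed)
    finally show ?case by simp
  qed (simp add: A.M.finsum_zero)
  have "(\<Oplus>\<^bsub>A\<^esub>b\<in>B. b \<otimes>\<^bsub>A\<^esub> d b) = (\<Oplus>\<^bsub>A\<^esub>b\<in>B. \<Oplus>\<^bsub>A\<^esub>c\<in>C. ?t b c)"
    using t by (intro A.M.finsum_cong') (auto simp: 1 intro!: A.M.finsum_closed)
  also have "\<dots> = (\<Oplus>\<^bsub>A\<^esub>c\<in>C. \<Oplus>\<^bsub>A\<^esub>b\<in>B. ?t b c)" by (rule swap) simp
  also have "\<dots> = e"
    unfolding e by (intro A.M.finsum_cong') (auto simp: 2 car)
  finally show "e = (\<Oplus>\<^bsub>A\<^esub>b\<in>B. b \<otimes>\<^bsub>A\<^esub> d b)" by simp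
qed (use B d in blast)

end

end

theory Submission
  imports Defs
begin

text \<open>The Euler class \<open>e\<close> satisfies \<open>f (a e) = tr (x \<mapsto> a x)\<close>. If \<open>u\<close> is the unit of a field
  factor, then \<open>f (u e) = dim (u A) \<noteq> 0\<close> in characteristic \<open>0\<close>, so \<open>u e\<close> is a unit of that factor
  and no power of \<open>e\<close> vanishes. Conversely, \<open>a\<^sup>2 = 0\<close> makes all the traces \<open>f (a x e)\<close> vanish, hence
  \<open>a e = 0\<close>. If \<open>e\<close> is not nilpotent, choose a non-nilpotent \<open>x \<in> e A\<close> with \<open>x A\<close> minimal; then
  \<open>x = x\<^sup>2 b\<close> and \<open>v = x b\<close> is idempotent. A nonzero nilpotent element of \<open>v A\<close> would have a nonzero
  multiple \<open>w\<close> in \<open>v A \<subseteq> e A\<close> with \<open>w\<^sup>2 = 0\<close>, but \<open>w = v w\<close> is a multiple of \<open>e w = 0\<close>. So each nonzero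
  element of \<open>v A\<close> generates \<open>v A\<close> by minimality, i.e. \<open>v A\<close> is a field.\<close>

section \<open>Direct sum decompositions and idempotents\<close>

text \<open>The Peirce corner \<open>v M\<close>. For an idempotent \<open>v\<close> the multiples
  of \<open>v\<close> are exactly the fixed points of multiplication by \<open>v\<close>, and
  \<open>v\<close> is their unit.\<close>

definition corner :: "('k, 'a, 'n) module_scheme \<Rightarrow> 'a \<Rightarrow> ('k, 'a) module"
  where "corner M v = \<lparr>carrier = {x \<in> carrier M. v \<otimes>\<^bsub>M\<^esub> x = x}, monoid.mult = (\<otimes>\<^bsub>M\<^esub>), one = v,
    ring.zero = \<zero>\<^bsub>M\<^esub>, ring.add = (\<oplus>\<^bsub>M\<^esub>), smult = (\<odot>\<^bsub>M\<^esub>)\<rparr>"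

lemma corner_simps [simp]:
  "carrier (corner M v) = {x \<in> carrier M. v \<otimes>\<^bsub>M\<^esub> x = x}"
  "x \<otimes>\<^bsub>corner M v\<^esub> y = x \<otimes>\<^bsub>M\<^esub> y"
  "\<one>\<^bsub>corner M v\<^esub> = v"
  "\<zero>\<^bsub>corner M v\<^esub> = \<zero>\<^bsub>M\<^esub>"
  "x \<oplus>\<^bsub>corner M v\<^esub> y = x \<oplus>\<^bsub>M\<^esub> y"
  "c \<odot>\<^bsub>corner M v\<^esub> x = c \<odot>\<^bsub>M\<^esub> x"
  by (simp_all add: corner_def)

lemma corner_algebra:
  assumes M: "algebra K M" and v: "v \<in> carrier M" "v \<otimes>\<^bsub>M\<^esub> v = v"
  shows "algebra K (corner M v)"
proof -
  interpret M: algebra K M by (fact M)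
  have smult: "v \<otimes>\<^bsub>M\<^esub> (c \<odot>\<^bsub>M\<^esub> x) = c \<odot>\<^bsub>M\<^esub> (v \<otimes>\<^bsub>M\<^esub> x)" if "c \<in> carrier K" "x \<in> carrier M" for c x
    using that v(1) by (simp add: M.m_comm[of v] M.smult_assoc2)
  have "abelian_group (corner M v)"
  proof (rule abelian_groupI)
    fix x assume "x \<in> carrier (corner M v)"
    then have x: "x \<in> carrier M" "v \<otimes>\<^bsub>M\<^esub> x = x" by auto
    then have "v \<otimes>\<^bsub>M\<^esub> (\<ominus>\<^bsub>M\<^esub> x) = \<ominus>\<^bsub>M\<^esub> x" using v by (simp add: M.r_minus)
    then show "\<exists>y\<in>carrier (corner M v). y \<oplus>\<^bsub>corner M v\<^esub> x = \<zero>\<^bsub>corner M v\<^esub>"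
      using x by (intro bexI[of _ "\<ominus>\<^bsub>M\<^esub> x"]) (auto simp: M.M.l_neg)
  qed (auto simp: v M.M.a_ac M.r_distr)
  moreover have "comm_monoid (corner M v)"
  proof (rule comm_monoidI)
    show "x \<otimes>\<^bsub>corner M v\<^esub> y \<in> carrier (corner M v)"
      if "x \<in> carrier (corner M v)" "y \<in> carrier (corner M v)" for x y
      using that v by (auto simp flip: M.m_assoc)
  qed (auto simp: v M.m_ac)
  ultimately have "cring (corner M v)"
    by (intro cringI) (auto simp: M.l_distr)
  with M.R_cring show ?thesis
    by (rule algebraI)
       (auto simp: smult M.smult_l_distr M.smult_r_distr M.smult_assoc1 M.smult_assoc2)
qed

text \<open>Peirce decomposition along complementary idempotents. The inverse map adds the two
  components: \<open>v + w = 1\<close> recovers every \<open>x\<close>, and by orthogonality each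
  idempotent kills the other corner.\<close>

lemma corner_decomposition:
  assumes M: "algebra K M" and v: "v \<in> carrier M" "v \<otimes>\<^bsub>M\<^esub> v = v"
    and w: "w \<in> carrier M" "w \<otimes>\<^bsub>M\<^esub> w = w"
    and vw: "v \<otimes>\<^bsub>M\<^esub> w = \<zero>\<^bsub>M\<^esub>" "v \<oplus>\<^bsub>M\<^esub> w = \<one>\<^bsub>M\<^esub>"
  shows "(\<lambda>x. (v \<otimes>\<^bsub>M\<^esub> x, w \<otimes>\<^bsub>M\<^esub> x)) \<in> algebra_iso K M (algebra_sum (corner M v) (corner M w))"
proof -
  interpret M: algebra K M by (fact M)
  let ?h = "\<lambda>x. (v \<otimes>\<^bsub>M\<^esub> x, w \<otimes>\<^bsub>M\<^esub> x)" and ?S = "algebra_sum (corner M v) (corner M w)"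
  have ww: "p \<otimes>\<^bsub>M\<^esub> (p \<otimes>\<^bsub>M\<^esub> x) = p \<otimes>\<^bsub>M\<^esub> x" if "p \<in> {v, w}" "x \<in> carrier M" for p x
    using that v w by (auto simp flip: M.m_assoc)
  have vw0: "v \<otimes>\<^bsub>M\<^esub> (w \<otimes>\<^bsub>M\<^esub> x) = \<zero>\<^bsub>M\<^esub>" "w \<otimes>\<^bsub>M\<^esub> (v \<otimes>\<^bsub>M\<^esub> x) = \<zero>\<^bsub>M\<^esub>" if "x \<in> carrier M" for x
    using that v w vw M.m_comm[of w v] by (auto simp flip: M.m_assoc)
  have mult: "p \<otimes>\<^bsub>M\<^esub> (x \<otimes>\<^bsub>M\<^esub> y) = (p \<otimes>\<^bsub>M\<^esub> x) \<otimes>\<^bsub>M\<^esub> (p \<otimes>\<^bsub>M\<^esub> y)"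
    if "p \<in> {v, w}" "x \<in> carrier M" "y \<in> carrier M" for p x y
  proof -
    have p: "p \<in> carrier M" "p \<otimes>\<^bsub>M\<^esub> p = p" using that v w by auto
    have "(p \<otimes>\<^bsub>M\<^esub> x) \<otimes>\<^bsub>M\<^esub> (p \<otimes>\<^bsub>M\<^esub> y) = (p \<otimes>\<^bsub>M\<^esub> p) \<otimes>\<^bsub>M\<^esub> (x \<otimes>\<^bsub>M\<^esub> y)"
      using that(2,3) p(1) by (simp add: M.m_ac)
    then show ?thesis using p by simp
  qed
  have bij: "bij_betw ?h (carrier M) (carrier ?S)"
  proof (rule bij_betw_byWitness[where f' = "\<lambda>(x, y). x \<oplus>\<^bsub>M\<^esub> y"])
    show "\<forall>x\<in>carrier M. (\<lambda>(x, y). x \<oplus>\<^bsub>M\<^esub> y) (?h x) = x"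
      using v w vw by (auto simp flip: M.l_distr)
    show "\<forall>p\<in>carrier ?S. ?h ((\<lambda>(x, y). x \<oplus>\<^bsub>M\<^esub> y) p) = p"
    proof
      fix p assume "p \<in> carrier ?S"
      then obtain x y where p: "p = (x, y)"
        and x: "x \<in> carrier M" "v \<otimes>\<^bsub>M\<^esub> x = x" and y: "y \<in> carrier M" "w \<otimes>\<^bsub>M\<^esub> y = y" by auto
      have "v \<otimes>\<^bsub>M\<^esub> y = \<zero>\<^bsub>M\<^esub>" "w \<otimes>\<^bsub>M\<^esub> x = \<zero>\<^bsub>M\<^esub>"
        using vw0(1)[OF y(1)] vw0(2)[OF x(1)] x y by simp_all
      then show "?h ((\<lambda>(x, y). x \<oplus>\<^bsub>M\<^esub> y) p) = p" using p x y v w by (simp add: M.r_distr)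
    qed
    show "?h ` carrier M \<subseteq> carrier ?S" using v w ww by auto
    show "(\<lambda>(x, y). x \<oplus>\<^bsub>M\<^esub> y) ` carrier ?S \<subseteq> carrier M" by auto
  qed
  have "?h \<in> ring_iso M ?S"
  proof (rule ring_iso_memI)
    show "?h x \<in> carrier ?S" if "x \<in> carrier M" for x using that v w ww by auto
    show "?h (x \<otimes>\<^bsub>M\<^esub> y) = ?h x \<otimes>\<^bsub>?S\<^esub> ?h y" if "x \<in> carrier M" "y \<in> carrier M" for x y
      using that mult by simp
    show "?h (x \<oplus>\<^bsub>M\<^esub> y) = ?h x \<oplus>\<^bsub>?S\<^esub> ?h y" if "x \<in> carrier M" "y \<in> carrier M" for x y
      using that v w by (simp add: M.r_distr)
    show "?h \<one>\<^bsub>M\<^esub> = \<one>\<^bsub>?S\<^esub>" using v w by simp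
  qed (fact bij)
  moreover have "?h (c \<odot>\<^bsub>M\<^esub> x) = c \<odot>\<^bsub>?S\<^esub> ?h x" if "c \<in> carrier K" "x \<in> carrier M" for c x
    using that v(1) w(1) by (simp add: M.m_comm[of v] M.m_comm[of w] M.smult_assoc2)
  ultimately show ?thesis by (simp add: algebra_iso_def)
qed

text \<open>The complementary idempotent \<open>w = 1 - v\<close> splits \<open>M\<close> into two
  corners, and the inverses supplied by \<open>inv\<close> make the first of them a field.\<close>

lemma has_field_factor_corner:
  assumes M: "algebra K M" and v: "v \<in> carrier M" "v \<otimes>\<^bsub>M\<^esub> v = v" "v \<noteq> \<zero>\<^bsub>M\<^esub>"
    and inv: "\<And>y. y \<in> carrier M \<Longrightarrow> v \<otimes>\<^bsub>M\<^esub> y = y \<Longrightarrow> y \<noteq> \<zero>\<^bsub>M\<^esub> \<Longrightarrow> \<exists>c\<in>carrier M. y \<otimes>\<^bsub>M\<^esub> c = v"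
  shows "has_field_factor K M"
proof -
  interpret M: algebra K M by (fact M)
  interpret C: algebra K "corner M v" by (rule corner_algebra[OF M v(1,2)])
  have "field (corner M v)"
  proof (rule cring.cring_fieldI2[OF C.M_cring])
    show "\<zero>\<^bsub>corner M v\<^esub> \<noteq> \<one>\<^bsub>corner M v\<^esub>" using v by simp
  next
    fix y assume "y \<in> carrier (corner M v)" "y \<noteq> \<zero>\<^bsub>corner M v\<^esub>"
    then have y: "y \<in> carrier M" "v \<otimes>\<^bsub>M\<^esub> y = y" "y \<noteq> \<zero>\<^bsub>M\<^esub>" by auto
    then obtain c where c: "c \<in> carrier M" "y \<otimes>\<^bsub>M\<^esub> c = v" using inv by blast
    \<comment> \<open>The inverse \<open>c\<close> is only known to lie in \<open>M\<close>;
      multiplication by \<open>v\<close> moves it into the corner.\<close>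
    have "y \<otimes>\<^bsub>M\<^esub> (v \<otimes>\<^bsub>M\<^esub> c) = (v \<otimes>\<^bsub>M\<^esub> y) \<otimes>\<^bsub>M\<^esub> c" using c y(1) v by (simp add: M.m_ac)
    also have "\<dots> = v" using y c by simp
    finally show "\<exists>q\<in>carrier (corner M v). y \<otimes>\<^bsub>corner M v\<^esub> q = \<one>\<^bsub>corner M v\<^esub>"
      using c v by (intro bexI[of _ "v \<otimes>\<^bsub>M\<^esub> c"]) (auto simp flip: M.m_assoc)
  qed
  define w where "w = \<one>\<^bsub>M\<^esub> \<ominus>\<^bsub>M\<^esub> v"
  have w: "w \<in> carrier M" using v by (simp add: w_def)
  have sum: "v \<oplus>\<^bsub>M\<^esub> w = \<one>\<^bsub>M\<^esub>"
    using v by (simp add: w_def a_minus_def M.M.a_lcomm[of v] M.M.r_neg)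
  have vw: "v \<otimes>\<^bsub>M\<^esub> w = \<zero>\<^bsub>M\<^esub>"
    using v by (simp add: w_def a_minus_def M.r_distr M.r_minus M.M.r_neg)
  \<comment> \<open>Multiplying \<open>v + w = 1\<close> by \<open>w\<close> gives
    \<open>w = w w\<close>, because \<open>v w\<close> vanishes.\<close>
  have "w = (v \<oplus>\<^bsub>M\<^esub> w) \<otimes>\<^bsub>M\<^esub> w" unfolding sum using w by simp
  also have "\<dots> = w \<otimes>\<^bsub>M\<^esub> w" using v w vw by (subst M.l_distr) auto
  finally have ww: "w \<otimes>\<^bsub>M\<^esub> w = w" by simp
  show ?thesis
    by (rule has_field_factorI[OF \<open>field (corner M v)\<close> corner_algebra[OF M v(1,2)]
        corner_algebra[OF M w ww] corner_decomposition[OF M v(1,2) w ww vw sum]])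
qed

text \<open>The preimage \<open>u\<close> of \<open>(1, 0)\<close> carries the field factor into
  \<open>M\<close> as the corner \<open>u M\<close>. This internal form replaces the isomorphism in
  the later argument.\<close>

lemma field_factor_idempotent:
  assumes M: "algebra K M" and "has_field_factor K M"
  shows "\<exists>u\<in>carrier M. u \<otimes>\<^bsub>M\<^esub> u = u \<and> u \<noteq> \<zero>\<^bsub>M\<^esub> \<and>
    (\<forall>x\<in>carrier M. u \<otimes>\<^bsub>M\<^esub> x \<noteq> \<zero>\<^bsub>M\<^esub> \<longrightarrow> (\<exists>y\<in>carrier M. u \<otimes>\<^bsub>M\<^esub> x \<otimes>\<^bsub>M\<^esub> y = u))"
proof -
  interpret M: algebra K M by (fact M)
  obtain F A' :: "('a, 'c) module" and h where F: "field F" and FA: "algebra K F" and A': "algebra K A'"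
    and h: "h \<in> algebra_iso K M (algebra_sum F A')"
    using assms(2) unfolding has_field_factor_def by blast
  interpret F: field F by (fact F)
  interpret A': algebra K A' by (fact A')
  let ?S = "algebra_sum F A'"
  have hiso: "h \<in> ring_iso M ?S" using h by (simp add: algebra_iso_def)
  have bij: "bij_betw h (carrier M) (carrier F \<times> carrier A')"
    using hiso by (simp add: ring_iso_def)
  have inj: "x = y" if "h x = h y" "x \<in> carrier M" "y \<in> carrier M" for x y
    using inj_onD[OF bij_betw_imp_inj_on[OF bij]] that by blast
  have surj: "\<exists>x\<in>carrier M. h x = p" if "p \<in> carrier F \<times> carrier A'" for p
    using bij_betw_imp_surj_on[OF bij] that by (metis imageE)
  have mult: "h (x \<otimes>\<^bsub>M\<^esub> y) = h x \<otimes>\<^bsub>?S\<^esub> h y" if "x \<in> carrier M" "y \<in> carrier M" for x y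
    using ring_iso_memE(2)[OF hiso] that by blast
  \<comment> \<open>The image of zero equals its own double, so both of its components are
    zero.\<close>
  have "h \<zero>\<^bsub>M\<^esub> \<oplus>\<^bsub>?S\<^esub> h \<zero>\<^bsub>M\<^esub> = h \<zero>\<^bsub>M\<^esub>"
    using ring_iso_memE(3)[OF hiso, of "\<zero>\<^bsub>M\<^esub>" "\<zero>\<^bsub>M\<^esub>"] by simp
  moreover obtain a b where ab: "h \<zero>\<^bsub>M\<^esub> = (a, b)" "a \<in> carrier F" "b \<in> carrier A'"
    using bij_betwE[OF bij] M.M.zero_closed by fastforce
  ultimately have h0: "h \<zero>\<^bsub>M\<^esub> = (\<zero>\<^bsub>F\<^esub>, \<zero>\<^bsub>A'\<^esub>)"
    by (simp add: F.add.r_cancel_one A'.M.add.r_cancel_one)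
  obtain u where u: "u \<in> carrier M" "h u = (\<one>\<^bsub>F\<^esub>, \<zero>\<^bsub>A'\<^esub>)"
    using surj[of "(\<one>\<^bsub>F\<^esub>, \<zero>\<^bsub>A'\<^esub>)"] by auto
  have "u \<otimes>\<^bsub>M\<^esub> u = u"
    by (rule inj) (use u in \<open>auto simp: mult\<close>)
  moreover have "u \<noteq> \<zero>\<^bsub>M\<^esub>" using u h0 by auto
  moreover have "\<exists>y\<in>carrier M. u \<otimes>\<^bsub>M\<^esub> x \<otimes>\<^bsub>M\<^esub> y = u" if x: "x \<in> carrier M" and ux: "u \<otimes>\<^bsub>M\<^esub> x \<noteq> \<zero>\<^bsub>M\<^esub>" for x
  proof -
    obtain a b where ab: "h x = (a, b)" "a \<in> carrier F" "b \<in> carrier A'"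
      using bij_betwE[OF bij] x by fastforce
    have hux: "h (u \<otimes>\<^bsub>M\<^esub> x) = (a, \<zero>\<^bsub>A'\<^esub>)" using u x ab by (simp add: mult)
    have "a \<noteq> \<zero>\<^bsub>F\<^esub>" using inj[of "u \<otimes>\<^bsub>M\<^esub> x" "\<zero>\<^bsub>M\<^esub>"] hux h0 u x ux by auto
    then have "a \<in> Units F" using ab by (simp add: F.field_Units)
    then obtain y where y: "y \<in> carrier M" "h y = (inv\<^bsub>F\<^esub> a, \<zero>\<^bsub>A'\<^esub>)" "a \<otimes>\<^bsub>F\<^esub> inv\<^bsub>F\<^esub> a = \<one>\<^bsub>F\<^esub>"
      using surj[of "(inv\<^bsub>F\<^esub> a, \<zero>\<^bsub>A'\<^esub>)"] by auto
    have "u \<otimes>\<^bsub>M\<^esub> x \<otimes>\<^bsub>M\<^esub> y = u"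
      by (rule inj) (use u x y hux in \<open>auto simp: mult[of "u \<otimes>\<^bsub>M\<^esub> x"]\<close>)
    then show ?thesis using y by blast
  qed
  ultimately show ?thesis using u by blast
qed

section \<open>Dual families and bases\<close>

context frobenius_algebra
begin

definition proj :: "'a set \<Rightarrow> ('a \<Rightarrow> 'a) \<Rightarrow> 'a \<Rightarrow> 'a"
  where "proj S d x = (\<Oplus>\<^bsub>A\<^esub>s\<in>S. f (x \<otimes>\<^bsub>A\<^esub> d s) \<odot>\<^bsub>A\<^esub> s)"

text \<open>The existence of some \<open>d\<close> with \<open>dual_pair S d\<close> replaces linear independence of \<open>S\<close>, and
  \<open>proj S d\<close> is a projection onto the span of \<open>S\<close>.\<close>

definition dual_pair :: "'a set \<Rightarrow> ('a \<Rightarrow> 'a) \<Rightarrow> bool"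
  where "dual_pair S d \<longleftrightarrow> finite S \<and> S \<subseteq> carrier A \<and> dual_basis K A f S d"

lemma dual_pairD:
  assumes "dual_pair S d"
  shows "finite S" and "S \<subseteq> carrier A" and "s \<in> S \<Longrightarrow> s \<in> carrier A" and "s \<in> S \<Longrightarrow> d s \<in> carrier A"
    and "s \<in> S \<Longrightarrow> s' \<in> S \<Longrightarrow> f (s \<otimes>\<^bsub>A\<^esub> d s') = (if s = s' then \<one>\<^bsub>K\<^esub> else \<zero>\<^bsub>K\<^esub>)"
  using assms by (auto simp: dual_pair_def dual_basis_def frobenius_form_def)

lemma form_finsum':
  assumes "finite B" "v \<in> B \<rightarrow> carrier A"
  shows "f (\<Oplus>\<^bsub>A\<^esub>b\<in>B. v b) = (\<Oplus>\<^bsub>K\<^esub>b\<in>B. f (v b))"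
  using assms
proof (induction rule: finite_induct)
  case (insert b B)
  then have "v \<in> B \<rightarrow> carrier A" "(\<lambda>b. f (v b)) \<in> B \<rightarrow> carrier K"
    by (auto simp: Pi_iff form_closed)
  with insert show ?case
    by (simp add: form_add form_closed Pi_iff A.M.finsum_closed)
qed (simp add: form_zero)

lemma form_mult_finsum:
  assumes "finite B" "c \<in> B \<rightarrow> carrier K" "v \<in> B \<rightarrow> carrier A" "y \<in> carrier A"
  shows "f ((\<Oplus>\<^bsub>A\<^esub>b\<in>B. c b \<odot>\<^bsub>A\<^esub> v b) \<otimes>\<^bsub>A\<^esub> y) = (\<Oplus>\<^bsub>K\<^esub>b\<in>B. c b \<otimes>\<^bsub>K\<^esub> f (v b \<otimes>\<^bsub>A\<^esub> y))"
proof -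
  have "(\<Oplus>\<^bsub>A\<^esub>b\<in>B. c b \<odot>\<^bsub>A\<^esub> v b) \<otimes>\<^bsub>A\<^esub> y = (\<Oplus>\<^bsub>A\<^esub>b\<in>B. (c b \<odot>\<^bsub>A\<^esub> v b) \<otimes>\<^bsub>A\<^esub> y)"
    using assms by (intro semiring.finsum_ldistr[OF A_semiring]) auto
  also have "\<dots> = (\<Oplus>\<^bsub>A\<^esub>b\<in>B. c b \<odot>\<^bsub>A\<^esub> (v b \<otimes>\<^bsub>A\<^esub> y))"
    using assms by (intro A.M.finsum_cong') (auto simp: Pi_iff A.smult_assoc2)
  also have "f \<dots> = (\<Oplus>\<^bsub>K\<^esub>b\<in>B. c b \<otimes>\<^bsub>K\<^esub> f (v b \<otimes>\<^bsub>A\<^esub> y))"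
    using assms by (intro form_finsum) auto
  finally show ?thesis .
qed

text \<open>Induction over the span of \<open>S\<close>: used with \<open>T\<close> the fixed points
  of a projection and with \<open>T\<close> an ideal.\<close>

lemma finsum_smult_mem:
  assumes "finite S" "c \<in> S \<rightarrow> carrier K" "S \<subseteq> T" "T \<subseteq> carrier A" "\<zero>\<^bsub>A\<^esub> \<in> T"
    and add: "\<And>x y. x \<in> T \<Longrightarrow> y \<in> T \<Longrightarrow> x \<oplus>\<^bsub>A\<^esub> y \<in> T"
    and smult: "\<And>k x. k \<in> carrier K \<Longrightarrow> x \<in> T \<Longrightarrow> k \<odot>\<^bsub>A\<^esub> x \<in> T"
  shows "(\<Oplus>\<^bsub>A\<^esub>s\<in>S. c s \<odot>\<^bsub>A\<^esub> s) \<in> T"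
  using assms(1-5)
proof (induction rule: finite_induct)
  case (insert s S)
  then have "(\<lambda>b. c b \<odot>\<^bsub>A\<^esub> b) \<in> S \<rightarrow> carrier A" by auto
  with insert show ?case
    by (subst A.M.finsum_insert) (auto intro!: add smult)
qed simp

section \<open>The projection onto a span is linear\<close>

lemma proj_closed: "dual_pair S d \<Longrightarrow> x \<in> carrier A \<Longrightarrow> proj S d x \<in> carrier A"
  unfolding proj_def by (intro A.M.finsum_closed) (auto simp: dual_pairD form_closed)

lemma proj_base:
  assumes S: "dual_pair S d" and t: "t \<in> S"
  shows "proj S d t = t"
proof -
  have "proj S d t = (\<Oplus>\<^bsub>A\<^esub>s\<in>S. if t = s then s else \<zero>\<^bsub>A\<^esub>)"
    unfolding proj_def using dual_pairD[OF S] t by (intro A.M.finsum_cong') auto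
  also have "\<dots> = t"
    using dual_pairD[OF S] t by (intro A.M.finsum_singleton) auto
  finally show ?thesis .
qed

lemma proj_zero: "dual_pair S d \<Longrightarrow> proj S d \<zero>\<^bsub>A\<^esub> = \<zero>\<^bsub>A\<^esub>"
  unfolding proj_def
  by (subst A.M.finsum_cong'[where g = "\<lambda>_. \<zero>\<^bsub>A\<^esub>" and B = S])
     (auto simp: dual_pairD form_zero A.M.finsum_zero)

lemma proj_add:
  assumes S: "dual_pair S d" and "x \<in> carrier A" "y \<in> carrier A"
  shows "proj S d (x \<oplus>\<^bsub>A\<^esub> y) = proj S d x \<oplus>\<^bsub>A\<^esub> proj S d y"
proof -
  have "proj S d (x \<oplus>\<^bsub>A\<^esub> y) =
      (\<Oplus>\<^bsub>A\<^esub>s\<in>S. f (x \<otimes>\<^bsub>A\<^esub> d s) \<odot>\<^bsub>A\<^esub> s \<oplus>\<^bsub>A\<^esub> f (y \<otimes>\<^bsub>A\<^esub> d s) \<odot>\<^bsub>A\<^esub> s)"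
    unfolding proj_def using assms dual_pairD[OF S]
    by (intro A.M.finsum_cong') (auto simp: A.l_distr form_add form_closed A.smult_l_distr)
  also have "\<dots> = proj S d x \<oplus>\<^bsub>A\<^esub> proj S d y"
    unfolding proj_def using assms dual_pairD[OF S]
    by (intro A.M.finsum_addf) (auto simp: form_closed)
  finally show ?thesis .
qed

lemma proj_smult:
  assumes S: "dual_pair S d" and "k \<in> carrier K" "x \<in> carrier A"
  shows "proj S d (k \<odot>\<^bsub>A\<^esub> x) = k \<odot>\<^bsub>A\<^esub> proj S d x"
proof -
  have "proj S d (k \<odot>\<^bsub>A\<^esub> x) = (\<Oplus>\<^bsub>A\<^esub>s\<in>S. k \<odot>\<^bsub>A\<^esub> (f (x \<otimes>\<^bsub>A\<^esub> d s) \<odot>\<^bsub>A\<^esub> s))"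
    unfolding proj_def using assms dual_pairD[OF S]
    by (intro A.M.finsum_cong') (auto simp: A.smult_assoc2 form_smult form_closed A.smult_assoc1)
  also have "\<dots> = k \<odot>\<^bsub>A\<^esub> proj S d x"
    unfolding proj_def using assms dual_pairD[OF S]
    by (intro A.finsum_smult_ldistr[symmetric]) (auto simp: form_closed)
  finally show ?thesis .
qed

text \<open>A Gram-Schmidt step for biorthogonal families. The hypothesis \<open>neq\<close> says
  that \<open>t\<close> lies outside the span of \<open>S\<close>, so nondegeneracy gives a vector
  that pairs nontrivially with the residue of \<open>t\<close>. The old dual vectors have to change
  as well.\<close>

lemma dual_pair_insert:
  assumes S: "dual_pair S d" and t: "t \<in> carrier A" and neq: "proj S d t \<noteq> t"
  shows "\<exists>d'. dual_pair (insert t S) d'"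
proof -
  note SD = dual_pairD[OF S]
  have p: "proj S d t \<in> carrier A" using S t by (rule proj_closed)
  \<comment> \<open>The new dual vector \<open>z\<close> is a vector \<open>y\<close> with \<open>f (q y) = 1\<close>, corrected to be orthogonal to \<open>S\<close>.\<close>
  define q where "q = t \<ominus>\<^bsub>A\<^esub> proj S d t"
  have q: "q \<in> carrier A" "q \<noteq> \<zero>\<^bsub>A\<^esub>"
    using t p neq by (auto simp: q_def A.r_right_minus_eq)
  then obtain x where x: "x \<in> carrier A" "f (q \<otimes>\<^bsub>A\<^esub> x) \<noteq> \<zero>\<^bsub>K\<^esub>"
    using nondegenerate unfolding nondegenerate_def frobenius_form_def by blast
  define c where "c = inv\<^bsub>K\<^esub> (f (q \<otimes>\<^bsub>A\<^esub> x))"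
  have "f (q \<otimes>\<^bsub>A\<^esub> x) \<in> Units K"
    using x q by (simp add: K.field_Units form_closed)
  then have c: "c \<in> carrier K" "c \<otimes>\<^bsub>K\<^esub> f (q \<otimes>\<^bsub>A\<^esub> x) = \<one>\<^bsub>K\<^esub>"
    unfolding c_def by simp_all
  define y where "y = c \<odot>\<^bsub>A\<^esub> x"
  have y: "y \<in> carrier A" using c x by (simp add: y_def)
  have qy: "f (q \<otimes>\<^bsub>A\<^esub> y) = \<one>\<^bsub>K\<^esub>"
  proof -
    have "q \<otimes>\<^bsub>A\<^esub> y = c \<odot>\<^bsub>A\<^esub> (q \<otimes>\<^bsub>A\<^esub> x)"
      using c x q by (simp add: y_def A.m_comm[of q] A.smult_assoc2)
    then show ?thesis using c x q by (simp add: form_smult)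
  qed
  \<comment> \<open>The combination of the old dual vectors that has the same pairing as
    \<open>y\<close> with every element of \<open>S\<close>.\<close>
  define r where "r = (\<Oplus>\<^bsub>A\<^esub>s\<in>S. f (s \<otimes>\<^bsub>A\<^esub> y) \<odot>\<^bsub>A\<^esub> d s)"
  have r: "r \<in> carrier A"
    unfolding r_def using SD y by (intro A.M.finsum_closed) (auto simp: form_closed)
  have fr: "f (w \<otimes>\<^bsub>A\<^esub> r) = (\<Oplus>\<^bsub>K\<^esub>s\<in>S. f (s \<otimes>\<^bsub>A\<^esub> y) \<otimes>\<^bsub>K\<^esub> f (w \<otimes>\<^bsub>A\<^esub> d s))"
    if w: "w \<in> carrier A" for w
  proof -
    have "f (w \<otimes>\<^bsub>A\<^esub> r) = f (r \<otimes>\<^bsub>A\<^esub> w)" using w r by (simp add: A.m_comm)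
    also have "\<dots> = (\<Oplus>\<^bsub>K\<^esub>s\<in>S. f (s \<otimes>\<^bsub>A\<^esub> y) \<otimes>\<^bsub>K\<^esub> f (d s \<otimes>\<^bsub>A\<^esub> w))"
      unfolding r_def using SD y w by (intro form_mult_finsum) (auto simp: form_closed)
    also have "\<dots> = (\<Oplus>\<^bsub>K\<^esub>s\<in>S. f (s \<otimes>\<^bsub>A\<^esub> y) \<otimes>\<^bsub>K\<^esub> f (w \<otimes>\<^bsub>A\<^esub> d s))"
      using SD y w by (intro K.finsum_cong') (auto simp: form_closed A.m_comm)
    finally show ?thesis .
  qed
  define z where "z = y \<ominus>\<^bsub>A\<^esub> r"
  have z: "z \<in> carrier A" using y r by (simp add: z_def)
  have mult_minus: "a \<otimes>\<^bsub>A\<^esub> (b \<ominus>\<^bsub>A\<^esub> b') = a \<otimes>\<^bsub>A\<^esub> b \<ominus>\<^bsub>A\<^esub> a \<otimes>\<^bsub>A\<^esub> b'"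
    if "a \<in> carrier A" "b \<in> carrier A" "b' \<in> carrier A" for a b b'
    using that cring.axioms(1)[OF A.M_cring] by (simp add: a_minus_def ring.ring_simprules)
  have fz: "f (w \<otimes>\<^bsub>A\<^esub> z) = f (w \<otimes>\<^bsub>A\<^esub> y) \<ominus>\<^bsub>K\<^esub> f (w \<otimes>\<^bsub>A\<^esub> r)" if w: "w \<in> carrier A" for w
    using w y r by (simp add: z_def mult_minus form_minus)
  have sz: "f (s \<otimes>\<^bsub>A\<^esub> z) = \<zero>\<^bsub>K\<^esub>" if s: "s \<in> S" for s
  proof -
    have "f (s \<otimes>\<^bsub>A\<^esub> r) = (\<Oplus>\<^bsub>K\<^esub>s'\<in>S. if s = s' then f (s' \<otimes>\<^bsub>A\<^esub> y) else \<zero>\<^bsub>K\<^esub>)"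
      unfolding fr[OF SD(3)[OF s]] using SD s y by (intro K.finsum_cong') (auto simp: form_closed)
    also have "\<dots> = f (s \<otimes>\<^bsub>A\<^esub> y)"
      using SD s y by (intro K.finsum_singleton) (auto simp: form_closed)
    finally show ?thesis using fz[OF SD(3)[OF s]] SD s y by (simp add: form_closed K.r_right_minus_eq)
  qed
  have tz: "f (t \<otimes>\<^bsub>A\<^esub> z) = \<one>\<^bsub>K\<^esub>"
  proof -
    \<comment> \<open>The projection is adjoint to the passage from \<open>y\<close> to
      \<open>r\<close>, so pairing \<open>t\<close> with \<open>y - r\<close> is the same as pairing
      \<open>q = t - proj S d t\<close> with \<open>y\<close>, which gives 1.\<close>
    have "f (proj S d t \<otimes>\<^bsub>A\<^esub> y) = (\<Oplus>\<^bsub>K\<^esub>s\<in>S. f (t \<otimes>\<^bsub>A\<^esub> d s) \<otimes>\<^bsub>K\<^esub> f (s \<otimes>\<^bsub>A\<^esub> y))"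
      unfolding proj_def using SD y t by (intro form_mult_finsum) (auto simp: form_closed)
    also have "\<dots> = f (t \<otimes>\<^bsub>A\<^esub> r)"
      unfolding fr[OF t] using SD y t by (intro K.finsum_cong') (auto simp: form_closed K.m_comm)
    finally have "f (t \<otimes>\<^bsub>A\<^esub> z) = f (t \<otimes>\<^bsub>A\<^esub> y) \<ominus>\<^bsub>K\<^esub> f (proj S d t \<otimes>\<^bsub>A\<^esub> y)"
      using fz[OF t] by simp
    also have "\<dots> = f (q \<otimes>\<^bsub>A\<^esub> y)"
      using t p y mult_minus[of y t "proj S d t"] by (simp add: q_def A.m_comm[of _ y] form_minus)
    finally show ?thesis by (simp add: qy)
  qed
  have tS: "t \<notin> S" using neq proj_base[OF S] by blast
  \<comment> \<open>Subtracting a multiple of \<open>z\<close> makes each old dual vector orthogonal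
    to \<open>t\<close>; its pairing with \<open>S\<close> stays the same since \<open>z\<close> is
    orthogonal to \<open>S\<close>.\<close>
  define d' where "d' s = (if s = t then z else d s \<ominus>\<^bsub>A\<^esub> f (t \<otimes>\<^bsub>A\<^esub> d s) \<odot>\<^bsub>A\<^esub> z)" for s
  have fd': "f (w \<otimes>\<^bsub>A\<^esub> d' s) = f (w \<otimes>\<^bsub>A\<^esub> d s) \<ominus>\<^bsub>K\<^esub> f (t \<otimes>\<^bsub>A\<^esub> d s) \<otimes>\<^bsub>K\<^esub> f (w \<otimes>\<^bsub>A\<^esub> z)"
    if "s \<in> S" "w \<in> carrier A" for s w
  proof -
    have "w \<otimes>\<^bsub>A\<^esub> (f (t \<otimes>\<^bsub>A\<^esub> d s) \<odot>\<^bsub>A\<^esub> z) = f (t \<otimes>\<^bsub>A\<^esub> d s) \<odot>\<^bsub>A\<^esub> (w \<otimes>\<^bsub>A\<^esub> z)"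
      using that SD t z by (simp add: A.m_comm[of w] A.smult_assoc2 form_closed)
    moreover have "s \<noteq> t" using that tS by blast
    ultimately show ?thesis
      using that SD t z by (simp add: d'_def mult_minus form_minus form_smult form_closed)
  qed
  have "f (w \<otimes>\<^bsub>A\<^esub> d' s) = (if w = s then \<one>\<^bsub>K\<^esub> else \<zero>\<^bsub>K\<^esub>)" if "w \<in> insert t S" "s \<in> insert t S" for w s
  proof (cases "s = t")
    case True
    then show ?thesis using that tz sz by (auto simp: d'_def)
  next
    case False
    then have s: "s \<in> S" using that by blast
    show ?thesis
    proof (cases "w = t")
      case True
      then show ?thesis using fd'[OF s t] False tz s SD t by (simp add: form_closed K.r_right_minus_eq)
    next
      case False
      then have "w \<in> S" using that by blast
      then show ?thesis using fd'[OF s, of w] sz[of w] s SD t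
        by (simp add: form_closed a_minus_def)
    qed
  qed
  moreover have "d' \<in> insert t S \<rightarrow> carrier A"
    using SD t z by (auto simp: d'_def form_closed)
  ultimately have "dual_pair (insert t S) d'"
    using SD t by (auto simp: dual_pair_def dual_basis_def frobenius_form_def)
  then show ?thesis by blast
qed

text \<open>The projection formula writes each vector as a combination of \<open>S\<close>, and
  pairing a vanishing combination with \<open>d t\<close> isolates the coefficient of
  \<open>t\<close>.\<close>

lemma finite_basisI:
  assumes S: "dual_pair S d" and fixed: "\<And>x. x \<in> carrier A \<Longrightarrow> proj S d x = x"
  shows "finite_basis K A S"
  unfolding finite_basis_def
proof (intro conjI ballI impI)
  note SD = dual_pairD[OF S]
  show "finite S" "S \<subseteq> carrier A" by (fact SD)+
  fix x assume x: "x \<in> carrier A"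
  show "\<exists>c\<in>S \<rightarrow> carrier K. x = (\<Oplus>\<^bsub>A\<^esub>b\<in>S. c b \<odot>\<^bsub>A\<^esub> b)"
    using fixed[OF x] x SD by (intro bexI[of _ "\<lambda>s. f (x \<otimes>\<^bsub>A\<^esub> d s)"]) (auto simp: proj_def form_closed)
next
  note SD = dual_pairD[OF S]
  fix c t assume c: "c \<in> S \<rightarrow> carrier K" and 0: "(\<Oplus>\<^bsub>A\<^esub>b\<in>S. c b \<odot>\<^bsub>A\<^esub> b) = \<zero>\<^bsub>A\<^esub>" and t: "t \<in> S"
  have "f ((\<Oplus>\<^bsub>A\<^esub>b\<in>S. c b \<odot>\<^bsub>A\<^esub> b) \<otimes>\<^bsub>A\<^esub> d t) = (\<Oplus>\<^bsub>K\<^esub>b\<in>S. c b \<otimes>\<^bsub>K\<^esub> f (b \<otimes>\<^bsub>A\<^esub> d t))"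
    using c SD t by (intro form_mult_finsum) auto
  also have "\<dots> = (\<Oplus>\<^bsub>K\<^esub>b\<in>S. if t = b then c b else \<zero>\<^bsub>K\<^esub>)"
    using c SD t by (intro K.finsum_cong') (auto simp: Pi_iff)
  also have "\<dots> = c t"
    using c SD t by (intro K.finsum_singleton) auto
  finally show "c t = \<zero>\<^bsub>K\<^esub>" using 0 SD t by (simp add: form_zero)
qed

text \<open>Among the families between \<open>S\<close> and \<open>T\<close> that have a dual, take
  \<open>R\<close> of greatest size. An element of \<open>T\<close> outside its span could still be
  inserted, so \<open>R\<close> spans \<open>T\<close>. The bound \<open>N\<close> makes a greatest
  size exist.\<close>

lemma proj_eq_maximal:
  assumes S: "dual_pair S d" and ST: "S \<subseteq> T" "T \<subseteq> carrier A"
    and bound: "\<And>R d'. dual_pair R d' \<Longrightarrow> R \<subseteq> T \<Longrightarrow> card R \<le> N"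
  shows "\<exists>R d'. dual_pair R d' \<and> S \<subseteq> R \<and> R \<subseteq> T \<and> (\<forall>t\<in>T. proj R d' t = t)"
proof -
  let ?P = "\<lambda>R. (\<exists>d'. dual_pair R d') \<and> S \<subseteq> R \<and> R \<subseteq> T"
  have "?P S" using S ST by blast
  moreover have "\<forall>R. ?P R \<longrightarrow> card R < Suc N" using bound by (auto simp: less_Suc_eq_le)
  ultimately obtain R where R: "?P R" and max: "\<And>R'. ?P R' \<Longrightarrow> card R' \<le> card R"
    using ex_has_greatest_nat[of ?P S card "Suc N"] by blast
  then obtain d' where d': "dual_pair R d'" by blast
  have "proj R d' t = t" if t: "t \<in> T" for t
  proof (rule ccontr)
    assume neq: "proj R d' t \<noteq> t"
    with dual_pair_insert[OF d'] t ST have "?P (insert t R)" using R by blast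
    then have "card (insert t R) \<le> card R" by (rule max)
    moreover have "t \<notin> R" using neq proj_base[OF d'] by blast
    ultimately show False using dual_pairD(1)[OF d'] by simp
  qed
  then show ?thesis using R d' by blast
qed

text \<open>A maximal family between \<open>S\<close> and \<open>S \<union> G\<close>, for a finite
  basis \<open>G\<close>, spans \<open>G\<close> and hence everything, as the fixed points of its
  projection form a subspace. The new \<open>d'\<close> need not agree with \<open>d\<close> on
  \<open>S\<close>. Taking \<open>S\<close> empty shows that a basis with a dual basis
  exists.\<close>

lemma extend_to_basis:
  assumes S: "dual_pair S d"
  shows "\<exists>B d'. dual_pair B d' \<and> S \<subseteq> B \<and> finite_basis K A B"
proof -
  obtain G where G: "finite_basis K A G" using finite_dimensional by (auto simp: finite_dimensional_def)
  then have fin: "finite G" "G \<subseteq> carrier A" by (auto simp: finite_basis_def)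
  note SD = dual_pairD[OF S]
  have "\<exists>B d'. dual_pair B d' \<and> S \<subseteq> B \<and> B \<subseteq> S \<union> G \<and> (\<forall>t\<in>S \<union> G. proj B d' t = t)"
    using SD fin by (intro proj_eq_maximal[OF S, where N = "card (S \<union> G)"]) (auto intro: card_mono)
  then obtain B d' where B: "dual_pair B d'" "S \<subseteq> B" and pG: "\<And>g. g \<in> G \<Longrightarrow> proj B d' g = g"
    by blast
  have "proj B d' x = x" if x: "x \<in> carrier A" for x
  proof -
    obtain c where c: "c \<in> G \<rightarrow> carrier K" "x = (\<Oplus>\<^bsub>A\<^esub>b\<in>G. c b \<odot>\<^bsub>A\<^esub> b)"
      using G x unfolding finite_basis_def by blast
    have "(\<Oplus>\<^bsub>A\<^esub>b\<in>G. c b \<odot>\<^bsub>A\<^esub> b) \<in> {x \<in> carrier A. proj B d' x = x}"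
      using c fin pG B by (intro finsum_smult_mem) (auto simp: proj_zero proj_add proj_smult)
    then show ?thesis using c by blast
  qed
  with B show ?thesis using finite_basisI by blast
qed

section \<open>The Euler class and traces\<close>

lemma dual_pair_empty: "dual_pair {} d"
  by (simp add: dual_pair_def dual_basis_def)

lemma euler_class_dual_pair:
  assumes "dual_pair B d" "finite_basis K A B"
  shows "euler_class K A f = (\<Oplus>\<^bsub>A\<^esub>b\<in>B. b \<otimes>\<^bsub>A\<^esub> d b)"
  using assms by (intro euler_class_eq) (auto simp: dual_pair_def)

lemma euler_class_closed: "euler_class K A f \<in> carrier A"
proof -
  obtain B d where B: "dual_pair B d" "finite_basis K A B"
    using extend_to_basis[OF dual_pair_empty] by blast
  show ?thesis
    unfolding euler_class_dual_pair[OF B] using dual_pairD[OF B(1)] by (intro A.M.finsum_closed) auto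
qed

text \<open>The right-hand side is the trace of multiplication by \<open>a\<close>:
  \<open>f (a b (d b))\<close> is the coefficient of \<open>b\<close> in the expansion of
  \<open>a b\<close>.\<close>

lemma form_mult_euler_class:
  assumes B: "dual_pair B d" "finite_basis K A B" and a: "a \<in> carrier A"
  shows "f (a \<otimes>\<^bsub>A\<^esub> euler_class K A f) = (\<Oplus>\<^bsub>K\<^esub>b\<in>B. f (a \<otimes>\<^bsub>A\<^esub> b \<otimes>\<^bsub>A\<^esub> d b))"
proof -
  note BD = dual_pairD[OF B(1)]
  have "a \<otimes>\<^bsub>A\<^esub> euler_class K A f = (\<Oplus>\<^bsub>A\<^esub>b\<in>B. a \<otimes>\<^bsub>A\<^esub> (b \<otimes>\<^bsub>A\<^esub> d b))"
    unfolding euler_class_dual_pair[OF B] using BD a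
    by (intro semiring.finsum_rdistr[OF A_semiring]) auto
  also have "\<dots> = (\<Oplus>\<^bsub>A\<^esub>b\<in>B. a \<otimes>\<^bsub>A\<^esub> b \<otimes>\<^bsub>A\<^esub> d b)"
    using BD a by (intro A.M.finsum_cong') (auto simp: A.m_assoc)
  also have "f \<dots> = (\<Oplus>\<^bsub>K\<^esub>b\<in>B. f (a \<otimes>\<^bsub>A\<^esub> b \<otimes>\<^bsub>A\<^esub> d b))"
    using BD a by (intro form_finsum') auto
  finally show ?thesis .
qed

text \<open>The trace of the identity: every diagonal coefficient is 1.\<close>

lemma form_euler_class:
  assumes B: "dual_pair B d" "finite_basis K A B"
  shows "f (euler_class K A f) = add_pow K (card B) \<one>\<^bsub>K\<^esub>"
proof -
  note BD = dual_pairD[OF B(1)]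
  have "f (euler_class K A f) = (\<Oplus>\<^bsub>K\<^esub>b\<in>B. f (\<one>\<^bsub>A\<^esub> \<otimes>\<^bsub>A\<^esub> b \<otimes>\<^bsub>A\<^esub> d b))"
    using form_mult_euler_class[OF B, of "\<one>\<^bsub>A\<^esub>"] euler_class_closed by simp
  also have "\<dots> = (\<Oplus>\<^bsub>K\<^esub>b\<in>B. \<one>\<^bsub>K\<^esub>)"
    using BD by (intro K.finsum_cong') auto
  also have "\<dots> = add_pow K (card B) \<one>\<^bsub>K\<^esub>"
    by (rule K.add.finprod_const) simp
  finally show ?thesis .
qed

text \<open>Since \<open>f e\<close> equals the size of any basis and \<open>e\<close> does not depend on the basis,
  characteristic \<open>0\<close> makes all bases equally large; no exchange argument is needed.\<close>

lemma card_dual_pair_bounded: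
  assumes "char_zero K"
  shows "\<exists>N. \<forall>S d. dual_pair S d \<longrightarrow> card S \<le> N"
proof -
  obtain B0 d0 where B0: "dual_pair B0 d0" "finite_basis K A B0"
    using extend_to_basis[OF dual_pair_empty] by blast
  have "card S \<le> card B0" if S: "dual_pair S d" for S d
  proof -
    obtain B d' where B: "dual_pair B d'" "S \<subseteq> B" "finite_basis K A B"
      using extend_to_basis[OF S] by blast
    have eq: "add_pow K (card B) \<one>\<^bsub>K\<^esub> = add_pow K (card B0) \<one>\<^bsub>K\<^esub>"
      using form_euler_class[OF B(1,3)] form_euler_class[OF B0] by simp
    have "m = n" if le: "m \<le> n" and mn: "add_pow K m \<one>\<^bsub>K\<^esub> = add_pow K n \<one>\<^bsub>K\<^esub>" for m n :: nat
    proof -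
      \<comment> \<open>Cancelling \<open>m\<close> copies of 1 leaves \<open>n - m\<close> copies
        with sum zero.\<close>
      have "add_pow K m \<one>\<^bsub>K\<^esub> \<oplus>\<^bsub>K\<^esub> add_pow K (n - m) \<one>\<^bsub>K\<^esub> = add_pow K m \<one>\<^bsub>K\<^esub>"
        using K.add.nat_pow_mult[of "\<one>\<^bsub>K\<^esub>" m "n - m"] le mn by simp
      then have "add_pow K (n - m) \<one>\<^bsub>K\<^esub> = \<zero>\<^bsub>K\<^esub>"
        by (simp add: K.add.r_cancel_one)
      then show "m = n" using assms le by (auto simp: char_zero_def)
    qed
    then have "card B = card B0" using eq by (metis nat_le_linear)
    then show ?thesis using B dual_pairD(1)[OF B(1)] by (metis card_mono)
  qed
  then show ?thesis by blast
qed

section \<open>Ideals as subspaces and their dimension\<close>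

lemma ideal_smult_closed:
  assumes "ideal I A" "k \<in> carrier K" "x \<in> I"
  shows "k \<odot>\<^bsub>A\<^esub> x \<in> I"
proof -
  interpret I: ideal I A by (fact assms)
  have x: "x \<in> carrier A" using assms(3) by (rule I.Icarr)
  have "(k \<odot>\<^bsub>A\<^esub> \<one>\<^bsub>A\<^esub>) \<otimes>\<^bsub>A\<^esub> x \<in> I" using assms by (intro I.I_l_closed) auto
  then show ?thesis using assms x by (simp add: A.smult_assoc2)
qed

lemma proj_mem_ideal:
  assumes S: "dual_pair S d" and I: "ideal I A" "S \<subseteq> I" and x: "x \<in> carrier A"
  shows "proj S d x \<in> I"
proof -
  interpret I: ideal I A by (fact I)
  show ?thesis
    unfolding proj_def using dual_pairD[OF S] I x
    by (intro finsum_smult_mem) (auto simp: form_closed I.Icarr ideal_smult_closed)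
qed

text \<open>For an ideal this is its dimension over \<open>K\<close>. Counting vectors that admit a
  dual family keeps the notion within \<open>dual_pair\<close>; in characteristic 0 these sizes are
  bounded, so the greatest one exists.\<close>

definition ideal_dim :: "'a set \<Rightarrow> nat"
  where "ideal_dim I = (GREATEST n. \<exists>S d. dual_pair S d \<and> S \<subseteq> I \<and> card S = n)"

lemma ideal_dim_attained:
  assumes "char_zero K"
  shows "\<exists>S d. dual_pair S d \<and> S \<subseteq> I \<and> card S = ideal_dim I"
proof -
  let ?Q = "\<lambda>n. \<exists>S d. dual_pair S d \<and> S \<subseteq> I \<and> card S = n"
  obtain N where N: "\<forall>S d. dual_pair S d \<longrightarrow> card S \<le> N" using card_dual_pair_bounded[OF assms] by blast
  have "?Q 0" using dual_pair_empty by (metis card.empty empty_subsetI)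
  moreover have "\<And>n. ?Q n \<Longrightarrow> n \<le> N" using N by blast
  ultimately show ?thesis
    unfolding ideal_dim_def by (rule GreatestI_nat[of ?Q])
qed

lemma ideal_dim_ge:
  assumes "char_zero K" "dual_pair S d" "S \<subseteq> I"
  shows "card S \<le> ideal_dim I"
proof -
  let ?Q = "\<lambda>n. \<exists>S d. dual_pair S d \<and> S \<subseteq> I \<and> card S = n"
  obtain N where N: "\<forall>S d. dual_pair S d \<longrightarrow> card S \<le> N" using card_dual_pair_bounded[OF assms(1)] by blast
  have "?Q (card S)" using assms by blast
  moreover have "\<And>n. ?Q n \<Longrightarrow> n \<le> N" using N by blast
  ultimately show ?thesis
    unfolding ideal_dim_def by (rule Greatest_le_nat[of ?Q])
qed

text \<open>A largest dual family inside \<open>I\<close> has its span inside \<open>I\<close>, so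
  any \<open>t\<close> in \<open>J\<close> but not in \<open>I\<close> could be inserted, giving a
  family in \<open>J\<close> that is too large.\<close>

lemma ideal_eqI_dim:
  assumes K0: "char_zero K" and I: "ideal I A" and J: "J \<subseteq> carrier A" and IJ: "I \<subseteq> J"
    and dim: "ideal_dim J \<le> ideal_dim I"
  shows "I = J"
proof (rule ccontr)
  assume "I \<noteq> J"
  then obtain t where t: "t \<in> J" "t \<notin> I" using IJ by blast
  obtain S d where S: "dual_pair S d" "S \<subseteq> I" "card S = ideal_dim I"
    using ideal_dim_attained[OF K0] by blast
  have "proj S d t \<noteq> t"
    using proj_mem_ideal[OF S(1) I S(2), of t] t J by auto
  then obtain d' where d': "dual_pair (insert t S) d'"
    using dual_pair_insert[OF S(1)] t J by blast
  have "card (insert t S) \<le> ideal_dim J"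
    by (rule ideal_dim_ge[OF K0 d']) (use t S IJ in auto)
  moreover have "t \<notin> S" using t S by blast
  ultimately show False using dim S dual_pairD(1)[OF S(1)] by simp
qed

text \<open>Multiplication by \<open>a\<close> maps into the ideal \<open>a A\<close>, so its trace
  can be taken there, where idempotent or square-zero \<open>a\<close> acts by 1 or 0. The clause on
  empty \<open>S\<close> is what remains of the fact that \<open>S\<close> spans
  \<open>a A\<close>.\<close>

lemma form_mult_euler_class_ideal:
  assumes K0: "char_zero K" and a: "a \<in> carrier A"
  shows "\<exists>S d. dual_pair S d \<and> S \<subseteq> PIdl\<^bsub>A\<^esub> a \<and> (S = {} \<longrightarrow> a = \<zero>\<^bsub>A\<^esub>) \<and>
    f (a \<otimes>\<^bsub>A\<^esub> euler_class K A f) = (\<Oplus>\<^bsub>K\<^esub>s\<in>S. f (a \<otimes>\<^bsub>A\<^esub> s \<otimes>\<^bsub>A\<^esub> d s))"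
proof -
  obtain N where N: "\<And>S d. dual_pair S d \<Longrightarrow> card S \<le> N" using card_dual_pair_bounded[OF K0] by blast
  have sub: "PIdl\<^bsub>A\<^esub> a \<subseteq> carrier A" using a by (auto simp: cgenideal_def)
  have "\<exists>S d. dual_pair S d \<and> {} \<subseteq> S \<and> S \<subseteq> PIdl\<^bsub>A\<^esub> a \<and> (\<forall>t\<in>PIdl\<^bsub>A\<^esub> a. proj S d t = t)"
    by (rule proj_eq_maximal[OF dual_pair_empty]) (use sub N in auto)
  then obtain S d where S: "dual_pair S d" "S \<subseteq> PIdl\<^bsub>A\<^esub> a" and pS: "\<And>t. t \<in> PIdl\<^bsub>A\<^esub> a \<Longrightarrow> proj S d t = t"
    by blast
  \<comment> \<open>In a basis adapted to \<open>a A\<close>, only the part inside \<open>a A\<close> contributes to the trace of \<open>a\<close>.\<close>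
  obtain B d' where B: "dual_pair B d'" "S \<subseteq> B" "finite_basis K A B"
    using extend_to_basis[OF S(1)] by blast
  note SD = dual_pairD[OF S(1)] and BD = dual_pairD[OF B(1)]
  have a_mem: "a \<in> PIdl\<^bsub>A\<^esub> a" using a by (rule A.cgenideal_self)
  \<comment> \<open>The dual family of the result is \<open>d'\<close>, coming from the whole basis;
    \<open>d\<close> only serves to expand elements of \<open>a A\<close> over
    \<open>S\<close>.\<close>
  have Sd': "dual_pair S d'"
    using B SD(1) by (auto simp: dual_pair_def dual_basis_def subset_iff)
  have 0: "f (a \<otimes>\<^bsub>A\<^esub> b \<otimes>\<^bsub>A\<^esub> d' b) = \<zero>\<^bsub>K\<^esub>" if b: "b \<in> B - S" for b
  proof -
    have bA: "b \<in> carrier A" "d' b \<in> carrier A" using b BD by auto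
    have "a \<otimes>\<^bsub>A\<^esub> b \<in> PIdl\<^bsub>A\<^esub> a" unfolding cgenideal_def using a bA A.m_comm by blast
    \<comment> \<open>Expand \<open>a b\<close> over \<open>S\<close>; the dual vector
      \<open>d' b\<close> is orthogonal to \<open>S\<close> because \<open>b\<close> is not in
      \<open>S\<close>.\<close>
    then have "f (a \<otimes>\<^bsub>A\<^esub> b \<otimes>\<^bsub>A\<^esub> d' b) = f (proj S d (a \<otimes>\<^bsub>A\<^esub> b) \<otimes>\<^bsub>A\<^esub> d' b)" by (simp add: pS)
    also have "\<dots> = (\<Oplus>\<^bsub>K\<^esub>s\<in>S. f (a \<otimes>\<^bsub>A\<^esub> b \<otimes>\<^bsub>A\<^esub> d s) \<otimes>\<^bsub>K\<^esub> f (s \<otimes>\<^bsub>A\<^esub> d' b))"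
      unfolding proj_def using SD bA a by (intro form_mult_finsum) (auto simp: form_closed)
    also have "\<dots> = (\<Oplus>\<^bsub>K\<^esub>s\<in>S. \<zero>\<^bsub>K\<^esub>)"
    proof (intro K.finsum_cong')
      fix s assume s: "s \<in> S"
      then have "f (s \<otimes>\<^bsub>A\<^esub> d' b) = \<zero>\<^bsub>K\<^esub>" using BD(5)[of s b] b B by auto
      then show "f (a \<otimes>\<^bsub>A\<^esub> b \<otimes>\<^bsub>A\<^esub> d s) \<otimes>\<^bsub>K\<^esub> f (s \<otimes>\<^bsub>A\<^esub> d' b) = \<zero>\<^bsub>K\<^esub>"
        using s SD bA a by (simp add: form_closed)
    qed auto
    finally show ?thesis by (simp add: K.finsum_zero)
  qed
  have "f (a \<otimes>\<^bsub>A\<^esub> euler_class K A f) = (\<Oplus>\<^bsub>K\<^esub>b\<in>B. f (a \<otimes>\<^bsub>A\<^esub> b \<otimes>\<^bsub>A\<^esub> d' b))"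
    by (rule form_mult_euler_class[OF B(1,3) a])
  also have "\<dots> = (\<Oplus>\<^bsub>K\<^esub>s\<in>S. f (a \<otimes>\<^bsub>A\<^esub> s \<otimes>\<^bsub>A\<^esub> d' s))"
    using B(2) BD a 0 by (intro K.add.finprod_mono_neutral_cong_right) (auto simp: form_closed)
  finally have "f (a \<otimes>\<^bsub>A\<^esub> euler_class K A f) = (\<Oplus>\<^bsub>K\<^esub>s\<in>S. f (a \<otimes>\<^bsub>A\<^esub> s \<otimes>\<^bsub>A\<^esub> d' s))" .
  moreover have "a = \<zero>\<^bsub>A\<^esub>" if "S = {}"
    using pS[OF a_mem] that by (simp add: proj_def)
  ultimately show ?thesis using Sd' S by blast
qed

text \<open>Multiplication by \<open>u\<close> fixes the spanning family \<open>S\<close> of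
  \<open>u A\<close>, so the trace is \<open>card S\<close> copies of 1. This is nonzero in
  characteristic 0, as \<open>S\<close> is nonempty.\<close>

lemma idempotent_mult_euler_class:
  assumes K0: "char_zero K" and u: "u \<in> carrier A" "u \<otimes>\<^bsub>A\<^esub> u = u" "u \<noteq> \<zero>\<^bsub>A\<^esub>"
  shows "u \<otimes>\<^bsub>A\<^esub> euler_class K A f \<noteq> \<zero>\<^bsub>A\<^esub>"
proof
  assume 0: "u \<otimes>\<^bsub>A\<^esub> euler_class K A f = \<zero>\<^bsub>A\<^esub>"
  obtain S d where S: "dual_pair S d" "S \<subseteq> PIdl\<^bsub>A\<^esub> u" "S \<noteq> {}"
    and tr: "f (u \<otimes>\<^bsub>A\<^esub> euler_class K A f) = (\<Oplus>\<^bsub>K\<^esub>s\<in>S. f (u \<otimes>\<^bsub>A\<^esub> s \<otimes>\<^bsub>A\<^esub> d s))"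
    using form_mult_euler_class_ideal[OF K0 u(1)] u(3) by blast
  note SD = dual_pairD[OF S(1)]
  have us: "u \<otimes>\<^bsub>A\<^esub> s = s" if s: "s \<in> S" for s
  proof -
    obtain x where x: "x \<in> carrier A" "s = x \<otimes>\<^bsub>A\<^esub> u" using subsetD[OF S(2) s] by (auto simp: cgenideal_def)
    then have "u \<otimes>\<^bsub>A\<^esub> s = x \<otimes>\<^bsub>A\<^esub> (u \<otimes>\<^bsub>A\<^esub> u)" using u(1) by (simp add: A.m_ac)
    then show ?thesis using x u by simp
  qed
  have "\<zero>\<^bsub>K\<^esub> = (\<Oplus>\<^bsub>K\<^esub>s\<in>S. f (u \<otimes>\<^bsub>A\<^esub> s \<otimes>\<^bsub>A\<^esub> d s))"
    unfolding tr[symmetric] 0 by (simp add: form_zero)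
  also have "\<dots> = (\<Oplus>\<^bsub>K\<^esub>s\<in>S. \<one>\<^bsub>K\<^esub>)"
    using SD us by (intro K.finsum_cong') auto
  also have "\<dots> = add_pow K (card S) \<one>\<^bsub>K\<^esub>"
    by (rule K.add.finprod_const) simp
  finally have "card S = 0" using K0 by (simp add: char_zero_def)
  then show False using S SD(1) by simp
qed

text \<open>Every multiple \<open>a x\<close> also squares to zero and so has trace zero. Thus
  \<open>a e\<close> pairs to zero with all \<open>x\<close>, and nondegeneracy applies.\<close>

lemma square_zero_mult_euler_class:
  assumes K0: "char_zero K" and a: "a \<in> carrier A" "a \<otimes>\<^bsub>A\<^esub> a = \<zero>\<^bsub>A\<^esub>"
  shows "a \<otimes>\<^bsub>A\<^esub> euler_class K A f = \<zero>\<^bsub>A\<^esub>"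
proof -
  let ?e = "euler_class K A f"
  have tr0: "f (b \<otimes>\<^bsub>A\<^esub> ?e) = \<zero>\<^bsub>K\<^esub>" if b: "b \<in> carrier A" "b \<otimes>\<^bsub>A\<^esub> b = \<zero>\<^bsub>A\<^esub>" for b
  proof -
    obtain S d where S: "dual_pair S d" "S \<subseteq> PIdl\<^bsub>A\<^esub> b"
      and tr: "f (b \<otimes>\<^bsub>A\<^esub> ?e) = (\<Oplus>\<^bsub>K\<^esub>s\<in>S. f (b \<otimes>\<^bsub>A\<^esub> s \<otimes>\<^bsub>A\<^esub> d s))"
      using form_mult_euler_class_ideal[OF K0 b(1)] by blast
    note SD = dual_pairD[OF S(1)]
    have bs: "b \<otimes>\<^bsub>A\<^esub> s = \<zero>\<^bsub>A\<^esub>" if s: "s \<in> S" for s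
    proof -
      obtain x where x: "x \<in> carrier A" "s = x \<otimes>\<^bsub>A\<^esub> b" using subsetD[OF S(2) s] by (auto simp: cgenideal_def)
      then have "b \<otimes>\<^bsub>A\<^esub> s = x \<otimes>\<^bsub>A\<^esub> (b \<otimes>\<^bsub>A\<^esub> b)" using b(1) by (simp add: A.m_ac)
      then show ?thesis using x b by simp
    qed
    have "(\<Oplus>\<^bsub>K\<^esub>s\<in>S. f (b \<otimes>\<^bsub>A\<^esub> s \<otimes>\<^bsub>A\<^esub> d s)) = (\<Oplus>\<^bsub>K\<^esub>s\<in>S. \<zero>\<^bsub>K\<^esub>)"
      using SD bs by (intro K.finsum_cong') (auto simp: form_zero)
    then show ?thesis unfolding tr by (simp add: K.finsum_zero)
  qed
  have "f (a \<otimes>\<^bsub>A\<^esub> ?e \<otimes>\<^bsub>A\<^esub> x) = \<zero>\<^bsub>K\<^esub>" if x: "x \<in> carrier A" for x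
  proof -
    have "(a \<otimes>\<^bsub>A\<^esub> x) \<otimes>\<^bsub>A\<^esub> (a \<otimes>\<^bsub>A\<^esub> x) = (a \<otimes>\<^bsub>A\<^esub> a) \<otimes>\<^bsub>A\<^esub> (x \<otimes>\<^bsub>A\<^esub> x)"
      using a(1) x by (simp add: A.m_ac)
    then have "f ((a \<otimes>\<^bsub>A\<^esub> x) \<otimes>\<^bsub>A\<^esub> ?e) = \<zero>\<^bsub>K\<^esub>" using a x by (intro tr0) auto
    moreover have "(a \<otimes>\<^bsub>A\<^esub> x) \<otimes>\<^bsub>A\<^esub> ?e = a \<otimes>\<^bsub>A\<^esub> ?e \<otimes>\<^bsub>A\<^esub> x"
      using a(1) x euler_class_closed by (simp add: A.m_ac)
    ultimately show ?thesis by simp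
  qed
  then show ?thesis
    using nondegenerate a euler_class_closed by (simp add: nondegenerate_def frobenius_form_def)
qed

section \<open>Minimal ideals\<close>

text \<open>Least dimension implies minimality under inclusion; this plays the part of the
  descending chain condition.\<close>

lemma exists_minimal_principal_ideal:
  assumes K0: "char_zero K" and x0: "x0 \<in> carrier A" "P x0"
  shows "\<exists>x\<in>carrier A. P x \<and>
    (\<forall>y\<in>carrier A. P y \<longrightarrow> PIdl\<^bsub>A\<^esub> y \<subseteq> PIdl\<^bsub>A\<^esub> x \<longrightarrow> PIdl\<^bsub>A\<^esub> y = PIdl\<^bsub>A\<^esub> x)"
proof -
  obtain x where x: "x \<in> carrier A" "P x"
    and min: "\<And>y. y \<in> carrier A \<Longrightarrow> P y \<Longrightarrow> ideal_dim (PIdl\<^bsub>A\<^esub> x) \<le> ideal_dim (PIdl\<^bsub>A\<^esub> y)"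
    using ex_has_least_nat[of "\<lambda>x. x \<in> carrier A \<and> P x" x0 "\<lambda>x. ideal_dim (PIdl\<^bsub>A\<^esub> x)"] x0 by blast
  have "PIdl\<^bsub>A\<^esub> y = PIdl\<^bsub>A\<^esub> x"
    if "y \<in> carrier A" "P y" "PIdl\<^bsub>A\<^esub> y \<subseteq> PIdl\<^bsub>A\<^esub> x" for y
    using that x min
    by (intro ideal_eqI_dim[OF K0 A.cgenideal_ideal]) (auto simp: cgenideal_def)
  with x show ?thesis by blast
qed

lemma nilpotent_square_zero:
  assumes y: "y \<in> carrier A" "y \<noteq> \<zero>\<^bsub>A\<^esub>" "nilpotent A y"
  shows "\<exists>z\<in>carrier A. y \<otimes>\<^bsub>A\<^esub> z \<noteq> \<zero>\<^bsub>A\<^esub> \<and> (y \<otimes>\<^bsub>A\<^esub> z) \<otimes>\<^bsub>A\<^esub> (y \<otimes>\<^bsub>A\<^esub> z) = \<zero>\<^bsub>A\<^esub>"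
proof -
  \<comment> \<open>The exponent of the last nonzero power of \<open>y\<close>; it is positive
    because \<open>y\<close> is nonzero. The witness is the power just below it.\<close>
  define n where "n = (LEAST n. y [^]\<^bsub>A\<^esub> Suc n = \<zero>\<^bsub>A\<^esub>)"
  obtain m where m: "m > 0" "y [^]\<^bsub>A\<^esub> (m::nat) = \<zero>\<^bsub>A\<^esub>" using y by (auto simp: nilpotent_def)
  then have "y [^]\<^bsub>A\<^esub> Suc (m - 1) = \<zero>\<^bsub>A\<^esub>" by simp
  then have n: "y [^]\<^bsub>A\<^esub> Suc n = \<zero>\<^bsub>A\<^esub>" unfolding n_def by (rule LeastI)
  have "n \<noteq> 0" using n y by (cases n) auto
  then obtain k where k: "n = Suc k" using not0_implies_Suc by blast
  have "y [^]\<^bsub>A\<^esub> Suc k \<noteq> \<zero>\<^bsub>A\<^esub>" using not_less_Least[of k "\<lambda>n. y [^]\<^bsub>A\<^esub> Suc n = \<zero>\<^bsub>A\<^esub>"] k by (auto simp: n_def)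
  moreover have pow: "y \<otimes>\<^bsub>A\<^esub> y [^]\<^bsub>A\<^esub> k = y [^]\<^bsub>A\<^esub> Suc k" using y by (simp add: A.m_comm)
  \<comment> \<open>With \<open>n = k + 1\<close> both sides have exponent \<open>2 k + 2\<close>,
    and the right one contains the vanishing power.\<close>
  moreover have "y [^]\<^bsub>A\<^esub> Suc k \<otimes>\<^bsub>A\<^esub> y [^]\<^bsub>A\<^esub> Suc k = y [^]\<^bsub>A\<^esub> Suc n \<otimes>\<^bsub>A\<^esub> y [^]\<^bsub>A\<^esub> k"
    using y(1) k by (simp only: A.nat_pow_mult) simp
  ultimately show ?thesis using n y by (intro bexI[of _ "y [^]\<^bsub>A\<^esub> k"]) (auto simp: pow)
qed

section \<open>A non-nilpotent Euler class yields a field factor\<close>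

lemma has_field_factor_if_not_nilpotent:
  assumes K0: "char_zero K" and e: "\<not> nilpotent A (euler_class K A f)"
  shows "has_field_factor K A"
proof -
  let ?e = "euler_class K A f"
  have eA: "?e \<in> carrier A" by (rule euler_class_closed)
  \<comment> \<open>Candidates are confined to multiples of the Euler class, so that anything killed
    by \<open>?e\<close> is also killed by \<open>x\<close>.\<close>
  define P where "P x \<longleftrightarrow> x \<in> PIdl\<^bsub>A\<^esub> ?e \<and> \<not> nilpotent A x" for x
  have "P ?e" using e A.cgenideal_self[OF eA] by (simp add: P_def)
  then obtain x where x: "x \<in> carrier A" "P x"
    and min: "\<And>y. y \<in> carrier A \<Longrightarrow> P y \<Longrightarrow> PIdl\<^bsub>A\<^esub> y \<subseteq> PIdl\<^bsub>A\<^esub> x \<Longrightarrow> PIdl\<^bsub>A\<^esub> y = PIdl\<^bsub>A\<^esub> x"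
    using exists_minimal_principal_ideal[OF K0 eA, of P] by blast
  interpret E: ideal "PIdl\<^bsub>A\<^esub> ?e" A using eA by (rule A.cgenideal_ideal)
  interpret X: ideal "PIdl\<^bsub>A\<^esub> x" A using x(1) by (rule A.cgenideal_ideal)
  have min': "PIdl\<^bsub>A\<^esub> (x \<otimes>\<^bsub>A\<^esub> z) = PIdl\<^bsub>A\<^esub> x"
    if z: "z \<in> carrier A" and nn: "\<not> nilpotent A (x \<otimes>\<^bsub>A\<^esub> z)" for z
  proof (rule min)
    show "x \<otimes>\<^bsub>A\<^esub> z \<in> carrier A" using x z by simp
    show "P (x \<otimes>\<^bsub>A\<^esub> z)" using E.I_r_closed[OF _ z] x(2) nn unfolding P_def by blast
    show "PIdl\<^bsub>A\<^esub> (x \<otimes>\<^bsub>A\<^esub> z) \<subseteq> PIdl\<^bsub>A\<^esub> x"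
      using x(1) z by (intro A.cgenideal_minimal X.I_r_closed A.cgenideal_self A.cgenideal_ideal)
  qed
  \<comment> \<open>Minimality then applies to \<open>x x\<close> and makes \<open>x\<close> a
    multiple of its own square.\<close>
  have "\<not> nilpotent A (x \<otimes>\<^bsub>A\<^esub> x)"
  proof
    assume "nilpotent A (x \<otimes>\<^bsub>A\<^esub> x)"
    then obtain n where n: "n > 0" "(x \<otimes>\<^bsub>A\<^esub> x) [^]\<^bsub>A\<^esub> (n::nat) = \<zero>\<^bsub>A\<^esub>" by (auto simp: nilpotent_def)
    then have "x [^]\<^bsub>A\<^esub> (n + n) = \<zero>\<^bsub>A\<^esub>" using x by (simp add: A.nat_pow_distrib A.nat_pow_mult)
    then have "nilpotent A x" using n unfolding nilpotent_def by (intro exI[of _ "n + n"]) auto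
    then show False using x by (simp add: P_def)
  qed
  then have "x \<in> PIdl\<^bsub>A\<^esub> (x \<otimes>\<^bsub>A\<^esub> x)" using min'[OF x(1)] A.cgenideal_self[OF x(1)] by simp
  then obtain b where b: "b \<in> carrier A" and xb: "x = b \<otimes>\<^bsub>A\<^esub> (x \<otimes>\<^bsub>A\<^esub> x)" unfolding cgenideal_def by blast
  define v where "v = x \<otimes>\<^bsub>A\<^esub> b"
  have v: "v \<in> carrier A" using x b by (simp add: v_def)
  have xv: "x \<otimes>\<^bsub>A\<^esub> v = x"
    using x(1) b by (subst (2) xb) (simp add: v_def A.m_ac)
  have vv: "v \<otimes>\<^bsub>A\<^esub> v = v"
  proof -
    have "v \<otimes>\<^bsub>A\<^esub> v = (x \<otimes>\<^bsub>A\<^esub> v) \<otimes>\<^bsub>A\<^esub> b" using x b v by (simp add: v_def A.m_ac)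
    then show ?thesis unfolding xv by (simp add: v_def)
  qed
  have "nilpotent A \<zero>\<^bsub>A\<^esub>"
    unfolding nilpotent_def by (intro exI[of _ 1]) simp
  then have "x \<noteq> \<zero>\<^bsub>A\<^esub>" using x(2) unfolding P_def by metis
  then have v0: "v \<noteq> \<zero>\<^bsub>A\<^esub>" using xv x by auto
  obtain r where r: "r \<in> carrier A" "x = r \<otimes>\<^bsub>A\<^esub> ?e" using x(2) unfolding P_def cgenideal_def by blast
  have "\<exists>c\<in>carrier A. y \<otimes>\<^bsub>A\<^esub> c = v"
    if y: "y \<in> carrier A" "v \<otimes>\<^bsub>A\<^esub> y = y" "y \<noteq> \<zero>\<^bsub>A\<^esub>" for y
  proof -
    have "\<not> nilpotent A y"
    proof
      assume "nilpotent A y"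
      then obtain z where z: "z \<in> carrier A" and w0: "y \<otimes>\<^bsub>A\<^esub> z \<noteq> \<zero>\<^bsub>A\<^esub>"
        and ww: "(y \<otimes>\<^bsub>A\<^esub> z) \<otimes>\<^bsub>A\<^esub> (y \<otimes>\<^bsub>A\<^esub> z) = \<zero>\<^bsub>A\<^esub>"
        using nilpotent_square_zero y by blast
      have we: "(y \<otimes>\<^bsub>A\<^esub> z) \<otimes>\<^bsub>A\<^esub> ?e = \<zero>\<^bsub>A\<^esub>"
        using y z ww by (intro square_zero_mult_euler_class[OF K0]) auto
      \<comment> \<open>Since \<open>v = x b = r e b\<close>, multiplication by \<open>v\<close>
        passes through the Euler class, which kills the square-zero element
        \<open>y z\<close>.\<close>
      have "y \<otimes>\<^bsub>A\<^esub> z = (v \<otimes>\<^bsub>A\<^esub> y) \<otimes>\<^bsub>A\<^esub> z" using y by simp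
      also have "\<dots> = (r \<otimes>\<^bsub>A\<^esub> b) \<otimes>\<^bsub>A\<^esub> ((y \<otimes>\<^bsub>A\<^esub> z) \<otimes>\<^bsub>A\<^esub> ?e)"
        unfolding v_def r(2) using y(1) z r(1) b eA by (simp add: A.m_ac)
      also have "\<dots> = \<zero>\<^bsub>A\<^esub>" unfolding we using r b by simp
      finally show False using w0 by simp
    qed
    \<comment> \<open>This writes \<open>y = v y\<close> as a multiple of \<open>x\<close>, the form
      in which \<open>min'\<close> applies.\<close>
    moreover have xby: "x \<otimes>\<^bsub>A\<^esub> (b \<otimes>\<^bsub>A\<^esub> y) = y" using x b y by (simp add: v_def A.m_assoc)
    ultimately have "PIdl\<^bsub>A\<^esub> y = PIdl\<^bsub>A\<^esub> x" using min'[of "b \<otimes>\<^bsub>A\<^esub> y"] b y by simp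
    moreover have "v \<in> PIdl\<^bsub>A\<^esub> x" unfolding v_def cgenideal_def using x b A.m_comm by blast
    ultimately obtain c where "c \<in> carrier A" "v = c \<otimes>\<^bsub>A\<^esub> y" unfolding cgenideal_def by blast
    then show ?thesis using y by (intro bexI[of _ c]) (auto simp: A.m_comm)
  qed
  then show ?thesis
    using v vv v0 by (intro has_field_factor_corner[OF A.algebra_axioms]) auto
qed

section \<open>A field factor keeps the Euler class from being nilpotent\<close>

lemma not_nilpotent_if_has_field_factor:
  assumes K0: "char_zero K" and F: "has_field_factor K A"
  shows "\<not> nilpotent A (euler_class K A f)"
proof
  let ?e = "euler_class K A f"
  have eA: "?e \<in> carrier A" by (rule euler_class_closed)
  obtain u where u: "u \<in> carrier A" "u \<otimes>\<^bsub>A\<^esub> u = u" "u \<noteq> \<zero>\<^bsub>A\<^esub>"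
    and inv: "\<And>x. x \<in> carrier A \<Longrightarrow> u \<otimes>\<^bsub>A\<^esub> x \<noteq> \<zero>\<^bsub>A\<^esub> \<Longrightarrow> \<exists>y\<in>carrier A. u \<otimes>\<^bsub>A\<^esub> x \<otimes>\<^bsub>A\<^esub> y = u"
    using field_factor_idempotent[OF A.algebra_axioms F] by blast
  obtain y where y: "y \<in> carrier A" "u \<otimes>\<^bsub>A\<^esub> ?e \<otimes>\<^bsub>A\<^esub> y = u"
    using inv[OF eA idempotent_mult_euler_class[OF K0 u]] by blast
  \<comment> \<open>As \<open>u e y = u\<close>, the element \<open>u\<close> absorbs one factor
    \<open>e\<close> and one factor \<open>y\<close> at each step. A vanishing power of
    \<open>e\<close> would therefore force \<open>u = 0\<close>.\<close>
  have pow: "?e [^]\<^bsub>A\<^esub> n \<otimes>\<^bsub>A\<^esub> (u \<otimes>\<^bsub>A\<^esub> y [^]\<^bsub>A\<^esub> n) = u" for n :: nat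
  proof (induction n)
    case (Suc n)
    have "?e [^]\<^bsub>A\<^esub> Suc n \<otimes>\<^bsub>A\<^esub> (u \<otimes>\<^bsub>A\<^esub> y [^]\<^bsub>A\<^esub> Suc n) =
        ?e [^]\<^bsub>A\<^esub> n \<otimes>\<^bsub>A\<^esub> ((u \<otimes>\<^bsub>A\<^esub> ?e \<otimes>\<^bsub>A\<^esub> y) \<otimes>\<^bsub>A\<^esub> y [^]\<^bsub>A\<^esub> n)"
      using u(1) y(1) eA by (simp add: A.m_ac)
    then show ?case using Suc y by simp
  qed (use u in simp)
  assume "nilpotent A ?e"
  then obtain n where "?e [^]\<^bsub>A\<^esub> (n::nat) = \<zero>\<^bsub>A\<^esub>" by (auto simp: nilpotent_def)
  then show False using pow[of n] u y by simp
qed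

end

theorem theorem2p1:
  fixes K :: "('k, 'm) ring_scheme" and A :: "('k, 'a, 'n) module_scheme" and f :: "'a \<Rightarrow> 'k"
  assumes "frobenius_algebra K A f"
    and "char_zero K"
  shows "has_field_factor K A \<longleftrightarrow> \<not> nilpotent A (euler_class K A f)"
proof -
  interpret frobenius_algebra K A f by (fact assms(1))
  show ?thesis
    using has_field_factor_if_not_nilpotent not_nilpotent_if_has_field_factor assms(2) by blast
qed

end
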